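(* Let $G$ be both a groupoid and a topological space (no compatibility assumed) with Hausdorff unit space $G^0$, and let $Y$ be a unital $1$-cancellative semigroup. If $S\subseteq{}_Y\mathcal{B}^\circ(G)$ is a bumpy semigroup with diagonal $D=\{d\in S:\mathrm{dom}(d)\subseteq G^0\}$, then $$g\mapsto S_g=\{a\in S:g\in\mathrm{int}([Y^\times]a)\}$$ is a homeomorphism from $G$ onto $\mathcal{U}(S)$. Moreover, for all $g,h\in G$ with $\mathsf{s}(g)=\mathsf{r}(h)$, $$S_{g^{-1}}=S_g^*\qquad\text{and}\qquad S_{gh}=(S_gS_h)^\prec.$$ Thus $\mathcal{U}(S)$ is an étale locally compact groupoid (with inverse $U\mapsto U^*$ and product $(S_g,S_h)\mapsto(S_gS_h)^\prec$ for $\mathsf{s}(g)=\mathsf{r}(h)$).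
   Context: For a groupoid $G$: $\mathsf{s}(g)=g^{-1}g$, $\mathsf{r}(g)=gg^{-1}$; $G^0$ is the set of units; $gh$ is defined iff $\mathsf{s}(g)=\mathsf{r}(h)$; for $X,X'\subseteq G$, $XX'=\{xx':x\in X,x'\in X',\mathsf{s}(x)=\mathsf{r}(x')\}$ and $X^{-1}=\{x^{-1}:x\in X\}$. A bisection is $B\subseteq G$ with $BB^{-1}\cup B^{-1}B\subseteq G^0$. $\mathcal{O}(G)$ is the topology of $G$, and $\mathcal{B}^\circ(G)$ is the set of open bisections. $\mathrm{int}$ denotes interior in $G$. A groupoid with a topology is étale if inversion and multiplication are continuous (on $G$ and on the set of composable pairs) and $\mathsf{s}$ is a local homeomorphism onto an open subset. Locally compact means that every point has a neighbourhood base of compact sets (compact sets need not be Hausdorff). A unital semigroup $Y$ is $1$-cancellative if for all $x,y\in Y$: $xy=x\Leftrightarrow y=1\Leftrightarrow yx=x$. $Y^\times$ denotes its invertible elements. For a family $\mathcal{X}$ of subsets of $G$, ${}_Y\mathcal{X}$ is the set of partial functions $a$ from $G$ to $Y$ with domain $\mathrm{dom}(a)\in\mathcal{X}$. For $W\subseteq Y$, $[W]a=\{g\in\mathrm{dom}(a):a(g)\in W\}$, and $[1]a=[\{1\}]a$. If $\mathrm{dom}(a)$ or $\mathrm{dom}(b)$ is a bisection, $ab$ is the function with domain $\mathrm{dom}(a)\mathrm{dom}(b)$ given by $ab(gh)=a(g)b(h)$ for $g\in\mathrm{dom}(a)$, $h\in\mathrm{dom}(b)$, $\mathsf{s}(g)=\mathsf{r}(h)$;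 semigroups of functions carry this product. $S\subseteq{}_Y\mathcal{B}^\circ(G)$ is bumpy if: (1-Proper) $[1]a$ is compact for all $a\in S$; (Urysohn) the empty function is in $S$, and whenever $g\in O\in\mathcal{O}(G)$ there is $a\in S$ with $\mathrm{dom}(a)\subseteq O$ and $g\in\mathrm{int}([Y^\times]a)$; (Involutive) whenever $a\in S$ and $g\in\mathrm{int}([Y^\times]a)$, there is $b\in S$ with $g^{-1}\in\mathrm{int}(\{h\in G:a(h^{-1})=b(h)^{-1}\})$. Domination on $S$ (relative to $D$): $a\prec_s b$ iff $asb=a=bsa$ and $as,sa\in D$; $a\prec b$ iff $a\prec_s b$ for some $s\in S$. A filter is a nonempty $F\subseteq S$ such that for all $a,b\in S$: $a,b\in F$ iff there is $c\in F$ with $c\prec a$ and $c\prec b$. Ultrafilters are the maximal proper ($\neq S$) filters; $\mathcal{U}(S)$ is the set of ultrafilters, with the topology generated by the basis of sets $\mathcal{U}_a=\{U\in\mathcal{U}(S):a\in U\}$, $a\in S$. For $T,T'\subseteq S$: $TT'=\{tt':t\in T,t'\in T'\}$, $T^\prec=\{a\in S:\exists t\in T\ (t\prec a)\}$ and $T^*=\{s\in S:\exists t\in T\ \exists r\in S\ (t\prec_s r)\}$. *)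

theory Defs
  imports "HOL-Analysis.Analysis" "HOL-Algebra.Group"
begin

section \<open>Groupoids\<close>

text \<open>The product \<open>gmult\<close> is a total function whose values matter only on pairs with
  \<open>src g = rng h\<close>; the partial product of the groupoid is its restriction to these pairs.\<close>

record 'g groupoid_struct = "'g partial_object" +
  gmult :: "'g \<Rightarrow> 'g \<Rightarrow> 'g" (infixl "\<odot>\<index>" 70)
  ginv :: "'g \<Rightarrow> 'g"

definition src :: "('g, 'm) groupoid_struct_scheme \<Rightarrow> 'g \<Rightarrow> 'g" where
  "src G g = ginv G g \<odot>\<^bsub>G\<^esub> g"

definition rng :: "('g, 'm) groupoid_struct_scheme \<Rightarrow> 'g \<Rightarrow> 'g" where
  "rng G g = g \<odot>\<^bsub>G\<^esub> ginv G g"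

definition gunits :: "('g, 'm) groupoid_struct_scheme \<Rightarrow> 'g set" where
  "gunits G = src G ` carrier G"

definition composable :: "('g, 'm) groupoid_struct_scheme \<Rightarrow> ('g \<times> 'g) set" where
  "composable G = {(g, h). g \<in> carrier G \<and> h \<in> carrier G \<and> src G g = rng G h}"

locale groupoid =
  fixes G (structure)
  assumes ginv_closed: "g \<in> carrier G \<Longrightarrow> ginv G g \<in> carrier G"
    and ginv_ginv: "g \<in> carrier G \<Longrightarrow> ginv G (ginv G g) = g"
    and gmult_closed: "(g, h) \<in> composable G \<Longrightarrow> g \<odot> h \<in> carrier G"
    and src_gmult: "(g, h) \<in> composable G \<Longrightarrow> src G (g \<odot> h) = src G h"
    and rng_gmult: "(g, h) \<in> composable G \<Longrightarrow> rng G (g \<odot> h) = rng G g"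
    and gmult_assoc: "\<lbrakk>(g, h) \<in> composable G; (h, k) \<in> composable G\<rbrakk>
          \<Longrightarrow> (g \<odot> h) \<odot> k = g \<odot> (h \<odot> k)"
    and ginv_gmult_cancel: "(g, h) \<in> composable G \<Longrightarrow> ginv G g \<odot> (g \<odot> h) = h"
    and gmult_ginv_cancel: "(g, h) \<in> composable G \<Longrightarrow> (g \<odot> h) \<odot> ginv G h = g"

definition set_gmult :: "('g, 'm) groupoid_struct_scheme \<Rightarrow> 'g set \<Rightarrow> 'g set \<Rightarrow> 'g set" where
  "set_gmult G A B = {g \<odot>\<^bsub>G\<^esub> h | g h. g \<in> A \<and> h \<in> B \<and> src G g = rng G h}"

definition bisection :: "('g, 'm) groupoid_struct_scheme \<Rightarrow> 'g set \<Rightarrow> bool" where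
  "bisection G B \<longleftrightarrow> B \<subseteq> carrier G \<and>
     set_gmult G B (ginv G ` B) \<union> set_gmult G (ginv G ` B) B \<subseteq> gunits G"

definition open_bisections ::
    "('g, 'm) groupoid_struct_scheme \<Rightarrow> 'g topology \<Rightarrow> 'g set set" where
  "open_bisections G X = {B. openin X B \<and> bisection G B}"

definition local_homeomorphism :: "'a topology \<Rightarrow> 'b topology \<Rightarrow> ('a \<Rightarrow> 'b) \<Rightarrow> bool" where
  "local_homeomorphism X Z f \<longleftrightarrow> f ` topspace X \<subseteq> topspace Z \<and>
     (\<forall>x \<in> topspace X. \<exists>U. openin X U \<and> x \<in> U \<and> openin Z (f ` U) \<and>
        homeomorphic_map (subtopology X U) (subtopology Z (f ` U)) f)"

definition etale_groupoid :: "('g, 'm) groupoid_struct_scheme \<Rightarrow> 'g topology \<Rightarrow> bool" where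
  "etale_groupoid G X \<longleftrightarrow> groupoid G \<and> topspace X = carrier G \<and>
     continuous_map X X (ginv G) \<and>
     continuous_map (subtopology (prod_topology X X) (composable G)) X (\<lambda>(g, h). g \<odot>\<^bsub>G\<^esub> h) \<and>
     openin X (gunits G) \<and>
     local_homeomorphism X (subtopology X (gunits G)) (src G)"

text \<open>This is stronger than the library's \<open>locally_compact_space\<close> when the space is not Hausdorff.\<close>

definition locally_compact_nbhds :: "'a topology \<Rightarrow> bool" where
  "locally_compact_nbhds X \<longleftrightarrow> neighbourhood_base_of (compactin X) X"

section \<open>Bumpy semigroups of partial functions\<close>

definition one_cancellative :: "('y, 'm) monoid_scheme \<Rightarrow> bool" where
  "one_cancellative Y \<longleftrightarrow> (\<forall>x \<in> carrier Y. \<forall>y \<in> carrier Y.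
     (x \<otimes>\<^bsub>Y\<^esub> y = x \<longleftrightarrow> y = \<one>\<^bsub>Y\<^esub>) \<and> (y = \<one>\<^bsub>Y\<^esub> \<longleftrightarrow> y \<otimes>\<^bsub>Y\<^esub> x = x))"

definition partial_funs :: "('y, 'm) monoid_scheme \<Rightarrow> 'g set set \<Rightarrow> ('g \<rightharpoonup> 'y) set" where
  "partial_funs Y \<X> = {a. dom a \<in> \<X> \<and> ran a \<subseteq> carrier Y}"

definition level_set :: "'y set \<Rightarrow> ('g \<rightharpoonup> 'y) \<Rightarrow> 'g set" where
  "level_set W a = {g \<in> dom a. the (a g) \<in> W}"

text \<open>The description is unique when \<open>dom a\<close> or \<open>dom b\<close> is a bisection, since then a
  factorisation \<open>k = g h\<close> with \<open>g \<in> dom a\<close> and \<open>h \<in> dom b\<close> is unique.\<close>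

definition pf_mult :: "('g, 'm) groupoid_struct_scheme \<Rightarrow> ('y, 'n) monoid_scheme
    \<Rightarrow> ('g \<rightharpoonup> 'y) \<Rightarrow> ('g \<rightharpoonup> 'y) \<Rightarrow> ('g \<rightharpoonup> 'y)" where
  "pf_mult G Y a b = (\<lambda>k.
     if k \<in> set_gmult G (dom a) (dom b)
     then Some (THE y. \<exists>g \<in> dom a. \<exists>h \<in> dom b.
            src G g = rng G h \<and> k = g \<odot>\<^bsub>G\<^esub> h \<and> y = the (a g) \<otimes>\<^bsub>Y\<^esub> the (b h))
     else None)"

definition bumpy :: "('g, 'm) groupoid_struct_scheme \<Rightarrow> 'g topology
    \<Rightarrow> ('y, 'n) monoid_scheme \<Rightarrow> ('g \<rightharpoonup> 'y) set \<Rightarrow> bool" where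
  "bumpy G X Y S \<longleftrightarrow>
     S \<subseteq> partial_funs Y (open_bisections G X) \<and>
     (\<forall>a \<in> S. compactin X (level_set {\<one>\<^bsub>Y\<^esub>} a)) \<and>
     Map.empty \<in> S \<and>
     (\<forall>g V. openin X V \<and> g \<in> V \<longrightarrow>
        (\<exists>a \<in> S. dom a \<subseteq> V \<and> g \<in> X interior_of (level_set (Units Y) a))) \<and>
     (\<forall>a \<in> S. \<forall>g \<in> X interior_of (level_set (Units Y) a). \<exists>b \<in> S.
        ginv G g \<in> X interior_of {h \<in> carrier G. ginv G h \<in> dom a \<and> h \<in> dom b \<and>
          the (b h) \<in> Units Y \<and> the (a (ginv G h)) = inv\<^bsub>Y\<^esub> (the (b h))})"

text \<open>Associativity of \<open>pf_mult\<close> on functions with bisection domains is automatic, so only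
  closure has to be required.\<close>

definition bumpy_semigroup :: "('g, 'm) groupoid_struct_scheme \<Rightarrow> 'g topology
    \<Rightarrow> ('y, 'n) monoid_scheme \<Rightarrow> ('g \<rightharpoonup> 'y) set \<Rightarrow> bool" where
  "bumpy_semigroup G X Y S \<longleftrightarrow>
     bumpy G X Y S \<and> (\<forall>a \<in> S. \<forall>b \<in> S. pf_mult G Y a b \<in> S)"

definition diagonal :: "('g, 'm) groupoid_struct_scheme \<Rightarrow> ('g \<rightharpoonup> 'y) set \<Rightarrow> ('g \<rightharpoonup> 'y) set" where
  "diagonal G S = {d \<in> S. dom d \<subseteq> gunits G}"

definition germ_set :: "'g topology \<Rightarrow> ('y, 'n) monoid_scheme \<Rightarrow> ('g \<rightharpoonup> 'y) set \<Rightarrow> 'g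
    \<Rightarrow> ('g \<rightharpoonup> 'y) set" where
  "germ_set X Y S g = {a \<in> S. g \<in> X interior_of (level_set (Units Y) a)}"

section \<open>Domination and ultrafilters\<close>

text \<open>Here \<open>mul\<close> is the product of an arbitrary semigroup \<open>S\<close> and \<open>D \<subseteq> S\<close> its diagonal.\<close>

definition dominated_via :: "('a \<Rightarrow> 'a \<Rightarrow> 'a) \<Rightarrow> 'a set \<Rightarrow> 'a \<Rightarrow> 'a \<Rightarrow> 'a \<Rightarrow> bool" where
  "dominated_via mul D s a b \<longleftrightarrow>
     mul (mul a s) b = a \<and> a = mul (mul b s) a \<and> mul a s \<in> D \<and> mul s a \<in> D"

definition dominated :: "('a \<Rightarrow> 'a \<Rightarrow> 'a) \<Rightarrow> 'a set \<Rightarrow> 'a set \<Rightarrow> 'a \<Rightarrow> 'a \<Rightarrow> bool" where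
  "dominated mul D S a b \<longleftrightarrow> (\<exists>s \<in> S. dominated_via mul D s a b)"

definition dom_filter :: "('a \<Rightarrow> 'a \<Rightarrow> 'a) \<Rightarrow> 'a set \<Rightarrow> 'a set \<Rightarrow> 'a set \<Rightarrow> bool" where
  "dom_filter mul D S F \<longleftrightarrow> F \<noteq> {} \<and> F \<subseteq> S \<and>
     (\<forall>a \<in> S. \<forall>b \<in> S. a \<in> F \<and> b \<in> F \<longleftrightarrow>
        (\<exists>c \<in> F. dominated mul D S c a \<and> dominated mul D S c b))"

definition ultrafilters :: "('a \<Rightarrow> 'a \<Rightarrow> 'a) \<Rightarrow> 'a set \<Rightarrow> 'a set \<Rightarrow> 'a set set" where
  "ultrafilters mul D S = {U. dom_filter mul D S U \<and> U \<noteq> S \<and>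
     (\<forall>F. dom_filter mul D S F \<and> F \<noteq> S \<and> U \<subseteq> F \<longrightarrow> F = U)}"

definition ultrafilter_topology :: "('a \<Rightarrow> 'a \<Rightarrow> 'a) \<Rightarrow> 'a set \<Rightarrow> 'a set \<Rightarrow> 'a set topology" where
  "ultrafilter_topology mul D S =
     topology_generated_by ((\<lambda>a. {U \<in> ultrafilters mul D S. a \<in> U}) ` S)"

definition set_mult :: "('a \<Rightarrow> 'a \<Rightarrow> 'a) \<Rightarrow> 'a set \<Rightarrow> 'a set \<Rightarrow> 'a set" where
  "set_mult mul T T' = {mul t t' | t t'. t \<in> T \<and> t' \<in> T'}"

definition up_closure :: "('a \<Rightarrow> 'a \<Rightarrow> 'a) \<Rightarrow> 'a set \<Rightarrow> 'a set \<Rightarrow> 'a set \<Rightarrow> 'a set" where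
  "up_closure mul D S T = {a \<in> S. \<exists>t \<in> T. dominated mul D S t a}"

definition star :: "('a \<Rightarrow> 'a \<Rightarrow> 'a) \<Rightarrow> 'a set \<Rightarrow> 'a set \<Rightarrow> 'a set \<Rightarrow> 'a set" where
  "star mul D S T = {s \<in> S. \<exists>t \<in> T. \<exists>r \<in> S. dominated_via mul D s t r}"

definition ultrafilter_groupoid ::
    "('a \<Rightarrow> 'a \<Rightarrow> 'a) \<Rightarrow> 'a set \<Rightarrow> 'a set \<Rightarrow> 'a set groupoid_struct" where
  "ultrafilter_groupoid mul D S =
     \<lparr>carrier = ultrafilters mul D S,
      gmult = (\<lambda>U V. up_closure mul D S (set_mult mul U V)),
      ginv = star mul D S\<rparr>"

end

theory Submission
  imports Defs
begin

text \<open>The hypotheses on \<open>S\<close> force the topology and the groupoid structure of \<open>G\<close> to be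
  compatible, and then the order-theoretic data of \<open>S\<close> can be read off pointwise.

  Compatibility comes first (\<open>etale\<close>). By (Urysohn) the domains of elements of \<open>S\<close> form a base of
  the topology, and since \<open>S\<close> is closed under products, the product of two basic open sets is again
  the domain of an element of \<open>S\<close>; hence products of open sets are open. (Involutive) gives, around
  any \<open>g\<close>, an open set whose inverse lies in a prescribed neighbourhood of \<open>ginv G g\<close>, so inversion
  is continuous. Open multiplication together with continuous inversion makes multiplication
  continuous, and the open bisections that form the base make \<open>src\<close> a local homeomorphism.

  The key translation (\<open>dominated_via_iff\<close>) is that \<open>a\<close> is dominated by \<open>b\<close> via \<open>s\<close> exactly when
  \<open>s (ginv G g)\<close> is a two-sided inverse of \<open>b g\<close> at every \<open>g \<in> dom a\<close>: 1-cancellativity lets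
  one cancel the value of \<open>a\<close>. So domination by \<open>b\<close> only depends on \<open>dom a\<close>, it puts \<open>dom a\<close>
  inside the open set where \<open>b\<close> is invertible, and (Involutive) with (Urysohn) supplies dominated
  elements around each point of that set. This makes every \<open>germ_set\<close> a proper filter, and it
  yields the formulas for inverses and products of germ sets.

  Compactness enters through \<open>dominated_source_compact\<close>: if \<open>s\<close> inverts \<open>b\<close> on \<open>dom a\<close>, then the
  product \<open>s b\<close> takes the value one on \<open>src G ` dom a\<close>, so (1-Proper) places this set inside a
  compact subset of \<open>src G ` dom b\<close>. In the Hausdorff unit space compact sets are closed, so the
  finite intersection property gives a unit common to all \<open>src G ` dom b\<close> with \<open>b\<close> in a proper
  filter; it lifts to one point \<open>g\<close> of all the domains because these are bisections. Thus every
  proper filter lies in some germ set. Inclusion between germ sets forces equality of the points,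
  again by the Hausdorff property of the units, so the ultrafilters are precisely the germ sets.
  The basic open sets of ultrafilters correspond to the open sets where some \<open>a \<in> S\<close> is invertible,
  which form a base of \<open>G\<close>; hence the bijection is a homeomorphism, and the etale and locally
  compact structure is carried over along it.\<close>

section \<open>Groupoids and bisections\<close>

context groupoid
begin

lemma src_ginv: "g \<in> carrier G \<Longrightarrow> src G (ginv G g) = rng G g"
  by (simp add: src_def rng_def ginv_ginv)

lemma rng_ginv: "g \<in> carrier G \<Longrightarrow> rng G (ginv G g) = src G g"
  by (simp add: src_def rng_def ginv_ginv)

lemma ginv_composable:
  assumes "g \<in> carrier G"
  shows "(ginv G g, g) \<in> composable G" and "(g, ginv G g) \<in> composable G"
  using assms by (simp_all add: composable_def ginv_closed src_ginv rng_ginv)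

lemma src_closed: "g \<in> carrier G \<Longrightarrow> src G g \<in> carrier G"
  and rng_closed: "g \<in> carrier G \<Longrightarrow> rng G g \<in> carrier G"
  by (simp_all add: src_def rng_def gmult_closed ginv_composable)

lemma src_src: "g \<in> carrier G \<Longrightarrow> src G (src G g) = src G g"
  using src_gmult[OF ginv_composable(1)] by (simp add: src_def)

lemma src_rng: "g \<in> carrier G \<Longrightarrow> src G (rng G g) = rng G g"
  using src_src[of "ginv G g"] by (simp add: src_ginv ginv_closed)

lemma rng_src: "g \<in> carrier G \<Longrightarrow> rng G (src G g) = src G g"
  using rng_gmult[OF ginv_composable(1)] rng_ginv by (simp add: src_def)

lemma gmult_src: "g \<in> carrier G \<Longrightarrow> g \<odot> src G g = g"
  using ginv_gmult_cancel[OF ginv_composable(1), of g] by (simp add: src_def ginv_ginv)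

lemma rng_gmult_self: "g \<in> carrier G \<Longrightarrow> rng G g \<odot> g = g"
  by (metis gmult_ginv_cancel ginv_composable(2) ginv_ginv rng_def)

lemma gunits_iff: "u \<in> gunits G \<longleftrightarrow> u \<in> carrier G \<and> src G u = u"
  unfolding gunits_def using src_closed src_src by (auto intro: rev_image_eqI)

lemma gunits_subset: "gunits G \<subseteq> carrier G"
  by (auto simp: gunits_iff)

lemma src_in_gunits: "g \<in> carrier G \<Longrightarrow> src G g \<in> gunits G"
  by (simp add: gunits_def)

lemma rng_in_gunits: "g \<in> carrier G \<Longrightarrow> rng G g \<in> gunits G"
  by (simp add: gunits_iff rng_closed src_rng)

lemma rng_unit: "u \<in> gunits G \<Longrightarrow> rng G u = u"
  by (metis gunits_iff rng_src)

text \<open>A product that is a unit must be \<open>rng G g\<close>, so multiplying by \<open>ginv G g\<close> on the left recovers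
  \<open>h\<close>.\<close>

lemma ginv_eq_if_product_unit:
  assumes gh: "(g, h) \<in> composable G" and u: "g \<odot> h \<in> gunits G"
  shows "h = ginv G g"
proof -
  have g: "g \<in> carrier G" using gh by (simp add: composable_def)
  have "g \<odot> h = rng G g" using rng_unit[OF u] rng_gmult[OF gh] by simp
  also have "\<dots> = src G (ginv G g)" using g by (simp add: src_ginv)
  finally have "ginv G g \<odot> (g \<odot> h) = ginv G g" using gmult_src g by (simp add: ginv_closed)
  then show ?thesis using ginv_gmult_cancel[OF gh] by simp
qed

lemma set_gmultI: "g \<in> A \<Longrightarrow> h \<in> B \<Longrightarrow> src G g = rng G h \<Longrightarrow> g \<odot> h \<in> set_gmult G A B"
  unfolding set_gmult_def by blast

lemma set_gmult_mono: "A \<subseteq> A' \<Longrightarrow> B \<subseteq> B' \<Longrightarrow> set_gmult G A B \<subseteq> set_gmult G A' B'"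
  unfolding set_gmult_def by blast

lemma bisection_subset: "bisection G B \<Longrightarrow> B \<subseteq> carrier G"
  by (simp add: bisection_def)

lemma bisection_src_inj:
  assumes B: "bisection G B" and "g \<in> B" "h \<in> B" and eq: "src G g = src G h"
  shows "g = h"
proof -
  have c: "g \<in> carrier G" "h \<in> carrier G" using assms bisection_subset by auto
  have "g \<odot> ginv G h \<in> gunits G"
  proof -
    have "g \<odot> ginv G h \<in> set_gmult G B (ginv G ` B)"
      using assms(2,3) eq rng_ginv[OF c(2)] by (intro set_gmultI) auto
    then show ?thesis using B by (auto simp: bisection_def)
  qed
  moreover have "(g, ginv G h) \<in> composable G"
    using c eq by (simp add: composable_def ginv_closed rng_ginv)
  ultimately have "ginv G h = ginv G g" by (rule ginv_eq_if_product_unit[rotated])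
  then show ?thesis by (metis c ginv_ginv)
qed

lemma bisection_rng_inj:
  assumes B: "bisection G B" and "g \<in> B" "h \<in> B" and eq: "rng G g = rng G h"
  shows "g = h"
proof -
  have c: "g \<in> carrier G" "h \<in> carrier G" using assms bisection_subset by auto
  have "ginv G g \<odot> h \<in> gunits G"
  proof -
    have "ginv G g \<odot> h \<in> set_gmult G (ginv G ` B) B"
      using assms(2,3) eq src_ginv[OF c(1)] by (intro set_gmultI) auto
    then show ?thesis using B by (auto simp: bisection_def)
  qed
  moreover have "(ginv G g, h) \<in> composable G"
    using c eq by (simp add: composable_def ginv_closed src_ginv)
  ultimately have "h = ginv G (ginv G g)" by (rule ginv_eq_if_product_unit[rotated])
  then show ?thesis by (metis c ginv_ginv)
qed

text \<open>This expresses \<open>src\<close> through set products, so that openness of products will give openness of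
  \<open>src\<close>.\<close>

lemma inverse_mult_bisection_subset:
  assumes B: "bisection G B" and U: "U \<subseteq> B"
  shows "set_gmult G (ginv G ` U) U = src G ` U"
proof -
  have s: "src G (ginv G g) = rng G g" if "g \<in> U" for g
    using that U bisection_subset[OF B] src_ginv by blast
  have eq: "g = h" if "g \<in> U" "h \<in> U" "src G (ginv G g) = rng G h" for g h
    using bisection_rng_inj[OF B, of g h] that U s by auto
  have "set_gmult G (ginv G ` U) U = (\<lambda>g. ginv G g \<odot> g) ` U"
  proof (intro equalityI subsetI)
    fix k assume "k \<in> set_gmult G (ginv G ` U) U"
    then obtain g h where "g \<in> U" "h \<in> U" "src G (ginv G g) = rng G h" "k = ginv G g \<odot> h"
      unfolding set_gmult_def by blast
    then show "k \<in> (\<lambda>g. ginv G g \<odot> g) ` U" using eq by blast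
  next
    fix k assume "k \<in> (\<lambda>g. ginv G g \<odot> g) ` U"
    then show "k \<in> set_gmult G (ginv G ` U) U" using s unfolding set_gmult_def by blast
  qed
  then show ?thesis by (simp add: src_def)
qed

end

section \<open>Products of functions on bisections\<close>

lemma dom_pf_mult: "dom (pf_mult G Y a b) = set_gmult G (dom a) (dom b)"
  by (auto simp: pf_mult_def dom_def)

text \<open>The range of a product determines its left factor in a bisection, and hence the right factor as
  well, so the definite description in \<open>pf_mult\<close> has a single candidate.\<close>

lemma (in groupoid) pf_mult_apply:
  assumes a: "bisection G (dom a)" and b: "dom b \<subseteq> carrier G"
    and g: "g \<in> dom a" and h: "h \<in> dom b" and gh: "src G g = rng G h"
  shows "pf_mult G Y a b (g \<odot> h) = Some (the (a g) \<otimes>\<^bsub>Y\<^esub> the (b h))"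
proof -
  have "g' = g \<and> h' = h"
    if "g' \<in> dom a" "h' \<in> dom b" "src G g' = rng G h'" "g \<odot> h = g' \<odot> h'" for g' h'
  proof -
    have c: "(g, h) \<in> composable G" "(g', h') \<in> composable G"
      using that g h gh b bisection_subset[OF a] by (auto simp: composable_def)
    have "rng G g' = rng G g" using rng_gmult c that(4) by metis
    then have "g' = g" using bisection_rng_inj[OF a] that(1) g by blast
    then show ?thesis using ginv_gmult_cancel c that(4) by metis
  qed
  then have "(THE y. \<exists>g' \<in> dom a. \<exists>h' \<in> dom b. src G g' = rng G h' \<and> g \<odot> h = g' \<odot> h'
      \<and> y = the (a g') \<otimes>\<^bsub>Y\<^esub> the (b h')) = the (a g) \<otimes>\<^bsub>Y\<^esub> the (b h)"
    by (intro the_equality) (use g h gh in blast)+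
  moreover have "g \<odot> h \<in> set_gmult G (dom a) (dom b)"
    using g h gh by (auto simp: set_gmult_def)
  ultimately show ?thesis by (simp add: pf_mult_def)
qed

section \<open>The topology of a groupoid with a bumpy semigroup\<close>

locale bumpy_functions = groupoid G + Y: monoid Y
  for G :: "('g, 'm) groupoid_struct_scheme" (structure)
    and Y :: "('y, 'n) monoid_scheme" +
  fixes X :: "'g topology" and S :: "('g \<rightharpoonup> 'y) set"
  assumes topspace_eq: "topspace X = carrier G"
    and Hausdorff_units: "Hausdorff_space (subtopology X (gunits G))"
    and cancel: "one_cancellative Y"
    and bumpy: "bumpy_semigroup G X Y S"
begin

abbreviation mul where "mul \<equiv> pf_mult G Y"
abbreviation D where "D \<equiv> diagonal G S"
abbreviation usupp where "usupp a \<equiv> X interior_of (level_set (Units Y) a)"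
abbreviation germs where "germs \<equiv> germ_set X Y S"

lemma dom_open: "a \<in> S \<Longrightarrow> openin X (dom a)"
  and dom_bisection: "a \<in> S \<Longrightarrow> bisection G (dom a)"
  and ran_subset: "a \<in> S \<Longrightarrow> ran a \<subseteq> carrier Y"
  and empty_in: "Map.empty \<in> S"
  and mul_closed: "a \<in> S \<Longrightarrow> b \<in> S \<Longrightarrow> mul a b \<in> S"
  and one_compact: "a \<in> S \<Longrightarrow> compactin X (level_set {\<one>\<^bsub>Y\<^esub>} a)"
  using bumpy unfolding bumpy_semigroup_def bumpy_def partial_funs_def open_bisections_def by auto

lemma dom_carrier: "a \<in> S \<Longrightarrow> dom a \<subseteq> carrier G"
  using dom_bisection bisection_subset by blast

lemma value_closed: "a \<in> S \<Longrightarrow> g \<in> dom a \<Longrightarrow> the (a g) \<in> carrier Y"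
  using ran_subset[of a] ranI[of a g] by auto

lemma urysohn:
  assumes "openin X V" and "g \<in> V"
  obtains a where "a \<in> S" "dom a \<subseteq> V" "g \<in> usupp a"
proof -
  have "\<forall>g V. openin X V \<and> g \<in> V \<longrightarrow> (\<exists>a \<in> S. dom a \<subseteq> V \<and> g \<in> usupp a)"
    using bumpy unfolding bumpy_semigroup_def bumpy_def by (elim conjE)
  then show thesis using assms that by blast
qed

lemma usupp_subset_dom: "usupp a \<subseteq> dom a"
  using interior_of_subset[of X "level_set (Units Y) a"] by (auto simp: level_set_def)

lemma mul_apply:
  assumes "a \<in> S" "b \<in> S" "g \<in> dom a" "h \<in> dom b" "src G g = rng G h"
  shows "mul a b (g \<odot> h) = Some (the (a g) \<otimes>\<^bsub>Y\<^esub> the (b h))"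
  using pf_mult_apply dom_bisection dom_carrier assms by blast

text \<open>Around \<open>g \<odot> h\<close> the domain of a product of two elements of \<open>S\<close> serves as an open neighbourhood;
  this is where closure of \<open>S\<close> under products acts on the topology.\<close>

lemma openin_set_gmult:
  assumes U: "openin X U" and V: "openin X V"
  shows "openin X (set_gmult G U V)"
proof (subst openin_subopen, intro ballI)
  fix k assume "k \<in> set_gmult G U V"
  then obtain g h where gh: "k = g \<odot> h" "g \<in> U" "h \<in> V" "src G g = rng G h"
    by (auto simp: set_gmult_def)
  obtain a where a: "a \<in> S" "dom a \<subseteq> U" "g \<in> usupp a" using urysohn[OF U gh(2)] .
  obtain b where b: "b \<in> S" "dom b \<subseteq> V" "h \<in> usupp b" using urysohn[OF V gh(3)] .
  have "openin X (dom (mul a b))" using a b by (simp add: dom_open mul_closed)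
  moreover have "k \<in> dom (mul a b)"
    unfolding dom_pf_mult gh(1)
    using gh(4) subsetD[OF usupp_subset_dom a(3)] subsetD[OF usupp_subset_dom b(3)]
    by (intro set_gmultI)
  moreover have "dom (mul a b) \<subseteq> set_gmult G U V"
    unfolding dom_pf_mult using a(2) b(2) by (rule set_gmult_mono)
  ultimately show "\<exists>T. openin X T \<and> k \<in> T \<and> T \<subseteq> set_gmult G U V"
    by (intro exI conjI)
qed

lemma involutive:
  assumes "a \<in> S" "g \<in> usupp a"
  obtains b where "b \<in> S" "ginv G g \<in> X interior_of {h \<in> carrier G. ginv G h \<in> dom a \<and> h \<in> dom b \<and>
          the (b h) \<in> Units Y \<and> the (a (ginv G h)) = inv\<^bsub>Y\<^esub> (the (b h))}"
proof -
  have "\<forall>a \<in> S. \<forall>g \<in> usupp a. \<exists>b \<in> S.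
      ginv G g \<in> X interior_of {h \<in> carrier G. ginv G h \<in> dom a \<and> h \<in> dom b \<and>
        the (b h) \<in> Units Y \<and> the (a (ginv G h)) = inv\<^bsub>Y\<^esub> (the (b h))}"
    using bumpy unfolding bumpy_semigroup_def bumpy_def by (elim conjE)
  then show thesis using assms that by meson
qed

text \<open>The set in (Involutive) is open around the inverse point by hypothesis and its inverse lies in
  \<open>dom a\<close>, which (Urysohn) allows to be arbitrarily small.\<close>

lemma continuous_ginv: "continuous_map X X (ginv G)"
  unfolding continuous_map_def
proof (intro conjI allI impI)
  show "ginv G \<in> topspace X \<rightarrow> topspace X" by (simp add: topspace_eq ginv_closed)
  fix V assume V: "openin X V"
  show "openin X {x \<in> topspace X. ginv G x \<in> V}"
  proof (subst openin_subopen, intro ballI)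
    fix x assume x: "x \<in> {x \<in> topspace X. ginv G x \<in> V}"
    then have xc: "x \<in> carrier G" by (simp add: topspace_eq)
    obtain a where a: "a \<in> S" "dom a \<subseteq> V" "ginv G x \<in> usupp a" using urysohn[OF V, of "ginv G x"] x by blast
    obtain b where b: "ginv G (ginv G x) \<in> X interior_of {h \<in> carrier G. ginv G h \<in> dom a \<and> h \<in> dom b \<and>
          the (b h) \<in> Units Y \<and> the (a (ginv G h)) = inv\<^bsub>Y\<^esub> (the (b h))}" (is "_ \<in> X interior_of ?M")
      using involutive[OF a(1,3)] .
    have "X interior_of ?M \<subseteq> {x \<in> topspace X. ginv G x \<in> V}"
      using interior_of_subset[of X ?M] a(2) by (auto simp: topspace_eq)
    moreover have "x \<in> X interior_of ?M" using b xc by (simp add: ginv_ginv)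
    ultimately show "\<exists>T. openin X T \<and> x \<in> T \<and> T \<subseteq> {x \<in> topspace X. ginv G x \<in> V}"
      using openin_interior_of by blast
  qed
qed

lemma openin_ginv_image:
  assumes "openin X U" shows "openin X (ginv G ` U)"
proof -
  have "homeomorphic_map X X (ginv G)"
    by (rule homeomorphic_map_involution[OF continuous_ginv]) (simp add: topspace_eq ginv_ginv)
  then show ?thesis using assms homeomorphic_map_openness_eq by blast
qed

lemma exists_open_bisection:
  assumes "openin X V" "g \<in> V"
  obtains B where "openin X B" "bisection G B" "g \<in> B" "B \<subseteq> V"
proof -
  obtain a where "a \<in> S" "dom a \<subseteq> V" "g \<in> usupp a" using urysohn[OF assms] .
  then show thesis using that[of "dom a"] dom_open dom_bisection usupp_subset_dom by blast
qed

lemma openin_src_image: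
  assumes U: "openin X U" and B: "bisection G B" "U \<subseteq> B"
  shows "openin X (src G ` U)"
  using openin_set_gmult[OF openin_ginv_image[OF U] U] inverse_mult_bisection_subset[OF B] by simp

lemma openin_gunits: "openin X (gunits G)"
proof (subst openin_subopen, intro ballI)
  fix u assume u: "u \<in> gunits G"
  then have "u \<in> topspace X" by (simp add: gunits_iff topspace_eq)
  then obtain B where B: "openin X B" "bisection G B" "u \<in> B"
    using exists_open_bisection[OF openin_topspace, of u] by blast
  have "src G u = u" using u by (simp add: gunits_iff)
  then have "u \<in> src G ` B" using B(3) by (metis imageI)
  moreover have "src G ` B \<subseteq> gunits G"
    using bisection_subset[OF B(2)] src_in_gunits by blast
  ultimately show "\<exists>T. openin X T \<and> u \<in> T \<and> T \<subseteq> gunits G"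
    using openin_src_image[OF B(1,2)] by blast
qed

text \<open>For an open bisection \<open>B\<close> around \<open>h\<close>, the set \<open>V B\<inverse>\<close> is an open neighbourhood of
  \<open>g = (g h) h\<inverse>\<close>, and \<open>(V B\<inverse>) B \<subseteq> V\<close> because \<open>B\<inverse> B\<close> consists of units.\<close>

lemma gmult_neighbourhoods:
  assumes gh: "(g, h) \<in> composable G" and V: "openin X V" "g \<odot> h \<in> V"
  obtains A B where "openin X A" "openin X B" "g \<in> A" "h \<in> B" "set_gmult G A B \<subseteq> V"
proof -
  have c: "g \<in> carrier G" "h \<in> carrier G" "src G g = rng G h"
    using gh by (auto simp: composable_def)
  obtain B where B: "openin X B" "bisection G B" "h \<in> B"
    using exists_open_bisection[OF openin_topspace, of h] c(2) by (auto simp: topspace_eq)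
  have V': "V \<subseteq> carrier G" using V(1) openin_subset topspace_eq by metis
  let ?A = "set_gmult G V (ginv G ` B)"
  have A: "openin X ?A" using openin_set_gmult V(1) openin_ginv_image B(1) by blast
  have "g = (g \<odot> h) \<odot> ginv G h" using gmult_ginv_cancel[OF gh] by simp
  moreover have "src G (g \<odot> h) = rng G (ginv G h)"
    using src_gmult[OF gh] rng_ginv c by simp
  ultimately have g: "g \<in> ?A" using V(2) B(3) unfolding set_gmult_def by blast
  have "set_gmult G ?A B \<subseteq> V"
  proof
    fix k assume "k \<in> set_gmult G ?A B"
    then obtain v b' b where k: "k = (v \<odot> ginv G b') \<odot> b" "v \<in> V" "b' \<in> B" "b \<in> B"
        "src G v = rng G (ginv G b')" "src G (v \<odot> ginv G b') = rng G b"
      unfolding set_gmult_def by blast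
    have kc: "v \<in> carrier G" "b' \<in> carrier G" using k V' bisection_subset[OF B(2)] by auto
    have cmp: "(v, ginv G b') \<in> composable G" using k(5) kc by (simp add: composable_def ginv_closed)
    have "rng G b' = rng G b" using src_gmult[OF cmp] k(6) src_ginv kc by simp
    then have "b' = b" using bisection_rng_inj[OF B(2)] k by blast
    then show "k \<in> V" using gmult_ginv_cancel[OF cmp] kc k(1,2) by (simp add: ginv_ginv)
  qed
  then show thesis using that[OF A B(1) g B(3)] by blast
qed

lemma continuous_gmult:
  "continuous_map (subtopology (prod_topology X X) (composable G)) X (\<lambda>(g, h). g \<odot> h)"
  (is "continuous_map ?P X ?f")
  unfolding continuous_map_def
proof (intro conjI allI impI)
  have tP: "topspace ?P = composable G"
    by (auto simp: topspace_eq composable_def)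
  show "?f \<in> topspace ?P \<rightarrow> topspace X" unfolding tP by (auto simp: topspace_eq gmult_closed)
  fix V assume V: "openin X V"
  show "openin ?P {x \<in> topspace ?P. ?f x \<in> V}" unfolding tP
  proof (subst openin_subopen, intro ballI)
    fix x assume "x \<in> {x \<in> composable G. ?f x \<in> V}"
    then obtain g h where x: "x = (g, h)" "(g, h) \<in> composable G" "g \<odot> h \<in> V"
      by (cases x) auto
    obtain A B where AB: "openin X A" "openin X B" "g \<in> A" "h \<in> B" "set_gmult G A B \<subseteq> V"
      using gmult_neighbourhoods[OF x(2) V x(3)] .
    have "openin ?P (composable G \<inter> A \<times> B)"
      using AB by (intro openin_subtopology_Int2) (simp add: openin_prod_Times_iff)
    moreover have "composable G \<inter> A \<times> B \<subseteq> {x \<in> composable G. ?f x \<in> V}"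
      using AB(5) by (auto simp: composable_def set_gmult_def)
    ultimately show "\<exists>T. openin ?P T \<and> x \<in> T \<and> T \<subseteq> {x \<in> composable G. ?f x \<in> V}"
      using x AB by blast
  qed
qed

lemma continuous_src: "continuous_map X (subtopology X (gunits G)) (src G)"
proof -
  have "continuous_map X (subtopology (prod_topology X X) (composable G)) (\<lambda>g. (ginv G g, g))"
    by (auto simp: continuous_map_in_subtopology continuous_map_pairwise o_def continuous_ginv
        topspace_eq ginv_composable)
  from continuous_map_compose[OF this continuous_gmult]
  have "continuous_map X X (src G)" by (simp add: o_def src_def[abs_def])
  then show ?thesis by (auto simp: continuous_map_in_subtopology topspace_eq src_in_gunits)
qed

text \<open>Injectivity is the bisection property; openness is \<open>openin_src_image\<close>.\<close>

lemma src_homeomorphic_on_bisection: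
  assumes B: "openin X B" "bisection G B"
  shows "homeomorphic_map (subtopology X B) (subtopology (subtopology X (gunits G)) (src G ` B)) (src G)"
proof (rule bijective_open_imp_homeomorphic_map)
  have Bc: "B \<subseteq> carrier G" using bisection_subset B(2) .
  have units: "src G ` B \<subseteq> gunits G" using Bc src_in_gunits by blast
  show "continuous_map (subtopology X B) (subtopology (subtopology X (gunits G)) (src G ` B)) (src G)"
    using continuous_src by (auto simp: continuous_map_in_subtopology continuous_map_from_subtopology)
  have "openin (subtopology X (src G ` B)) (src G ` U)" if "openin X U" "U \<subseteq> B" for U
    using openin_src_image[OF that(1) B(2) that(2)] that(2)
    by (metis image_mono inf.absorb_iff2 openin_subtopology_Int2)
  then show "open_map (subtopology X B) (subtopology (subtopology X (gunits G)) (src G ` B)) (src G)"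
    using B(1) units unfolding open_map_def subtopology_subtopology
    by (simp add: inf.absorb2 openin_open_subtopology)
  show "src G ` topspace (subtopology X B) = topspace (subtopology (subtopology X (gunits G)) (src G ` B))"
    using Bc units gunits_subset by (auto simp: topspace_eq)
  show "inj_on (src G) (topspace (subtopology X B))"
    using bisection_src_inj[OF B(2)] by (auto simp: inj_on_def)
qed

theorem etale: "etale_groupoid G X"
proof -
  have "groupoid G" by unfold_locales
  moreover have "local_homeomorphism X (subtopology X (gunits G)) (src G)"
    unfolding local_homeomorphism_def
  proof (intro conjI ballI)
    show "src G ` topspace X \<subseteq> topspace (subtopology X (gunits G))"
      using src_in_gunits src_closed by (auto simp: topspace_eq)
    fix x assume "x \<in> topspace X"
    then obtain B where B: "openin X B" "bisection G B" "x \<in> B"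
      using exists_open_bisection[OF openin_topspace, of x] by blast
    have "openin (subtopology X (gunits G)) (src G ` B)"
      using openin_src_image[OF B(1,2)] openin_open_subtopology[OF openin_gunits]
        bisection_subset[OF B(2)] src_in_gunits by blast
    then show "\<exists>U. openin X U \<and> x \<in> U \<and> openin (subtopology X (gunits G)) (src G ` U) \<and>
        homeomorphic_map (subtopology X U) (subtopology (subtopology X (gunits G)) (src G ` U)) (src G)"
      using B(1,3) src_homeomorphic_on_bisection[OF B(1,2)] by blast
  qed
  ultimately show ?thesis
    unfolding etale_groupoid_def
    using topspace_eq continuous_ginv continuous_gmult openin_gunits by (intro conjI)
qed

section \<open>Domination as local inversion\<close>

text \<open>The value of \<open>s\<close> is taken at the inverse groupoid element, since \<open>s\<close> is to behave like
  \<open>g \<mapsto> (b (g\<inverse>))\<inverse>\<close> near the points of \<open>N\<inverse>\<close>.\<close>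

definition inverts_on :: "('g \<rightharpoonup> 'y) \<Rightarrow> ('g \<rightharpoonup> 'y) \<Rightarrow> 'g set \<Rightarrow> bool" where
  "inverts_on s b N \<longleftrightarrow> (\<forall>g \<in> N. g \<in> dom b \<and> ginv G g \<in> dom s \<and>
     the (s (ginv G g)) \<otimes>\<^bsub>Y\<^esub> the (b g) = \<one>\<^bsub>Y\<^esub> \<and> the (b g) \<otimes>\<^bsub>Y\<^esub> the (s (ginv G g)) = \<one>\<^bsub>Y\<^esub>)"

lemma inverts_on_mono: "inverts_on s b N \<Longrightarrow> M \<subseteq> N \<Longrightarrow> inverts_on s b M"
  by (auto simp: inverts_on_def)

text \<open>A point \<open>g \<in> dom a\<close> factors as \<open>(p t) k\<close> with \<open>p \<in> dom a\<close>, \<open>t \<in> dom s\<close>, \<open>k \<in> dom b\<close>. The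
  diagonal condition makes \<open>p t\<close> a unit, so \<open>k = g\<close> and \<open>t = p\<inverse>\<close>, and the bisection property gives
  \<open>p = g\<close>. Comparing values, \<open>a g = a g s(g\<inverse>) b g\<close>, and 1-cancellativity removes \<open>a g\<close>.\<close>

lemma inverts_on_if_dominated_via:
  assumes S: "a \<in> S" "b \<in> S" "s \<in> S" and dv: "dominated_via mul D s a b"
  shows "inverts_on s b (dom a)"
  unfolding inverts_on_def
proof
  fix g assume g: "g \<in> dom a"
  have eq: "mul (mul a s) b = a" and as: "dom (mul a s) \<subseteq> gunits G"
    using dv by (auto simp: dominated_via_def diagonal_def)
  have "g \<in> set_gmult G (dom (mul a s)) (dom b)" using g eq dom_pf_mult by metis
  then obtain x k where x: "x \<in> dom (mul a s)" "k \<in> dom b" "src G x = rng G k" "g = x \<odot> k"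
    by (auto simp: set_gmult_def)
  then obtain p t where p: "p \<in> dom a" "t \<in> dom s" "src G p = rng G t" "x = p \<odot> t"
    by (auto simp: dom_pf_mult set_gmult_def)
  have c: "p \<in> carrier G" "t \<in> carrier G" "k \<in> carrier G" "g \<in> carrier G"
    using p x g S dom_carrier by auto
  have pt: "(p, t) \<in> composable G" using c p by (simp add: composable_def)
  have xu: "x \<in> gunits G" using x as by blast
  have t: "t = ginv G p" using ginv_eq_if_product_unit[OF pt] xu p by simp
  have xk: "x = rng G k" using xu x(3) by (simp add: gunits_iff)
  then have k: "k = g" using x(4) rng_gmult_self c by simp
  have "rng G p = x" using rng_gmult[OF pt] rng_unit[OF xu] p(4) by simp
  then have pg: "p = g" using bisection_rng_inj[OF dom_bisection[OF S(1)] p(1) g] xk k by simp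
  have gb: "g \<in> dom b" using x(2) k by simp
  have gs: "ginv G g \<in> dom s" using p(2) t pg by simp
  let ?s = "the (s (ginv G g))" and ?b = "the (b g)" and ?a = "the (a g)"
  have v: "?s \<in> carrier Y" "?b \<in> carrier Y" "?a \<in> carrier Y"
    using value_closed[OF S(3) gs] value_closed[OF S(2) gb] value_closed[OF S(1) g] .
  have mx: "mul a s x = Some (?a \<otimes>\<^bsub>Y\<^esub> ?s)"
    using mul_apply[OF S(1,3) p(1-3)] p(4) unfolding t pg by simp
  have "mul (mul a s) b g = Some (the (mul a s x) \<otimes>\<^bsub>Y\<^esub> the (b k))"
    unfolding x(4) by (rule mul_apply[OF mul_closed[OF S(1,3)] S(2) x(1-3)])
  then have "a g = Some (?a \<otimes>\<^bsub>Y\<^esub> ?s \<otimes>\<^bsub>Y\<^esub> ?b)"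
    unfolding eq k mx option.sel .
  then have "?a = ?a \<otimes>\<^bsub>Y\<^esub> ?s \<otimes>\<^bsub>Y\<^esub> ?b" by (metis option.sel)
  then have "?a \<otimes>\<^bsub>Y\<^esub> (?s \<otimes>\<^bsub>Y\<^esub> ?b) = ?a" using v by (metis Y.m_assoc)
  then have sb: "?s \<otimes>\<^bsub>Y\<^esub> ?b = \<one>\<^bsub>Y\<^esub>" using cancel v by (simp add: one_cancellative_def)
  \<comment> \<open>In a 1-cancellative monoid a one-sided inverse is two-sided.\<close>
  have "?b \<otimes>\<^bsub>Y\<^esub> (?s \<otimes>\<^bsub>Y\<^esub> ?b) = ?b" using v sb by simp
  then have "?b \<otimes>\<^bsub>Y\<^esub> ?s \<otimes>\<^bsub>Y\<^esub> ?b = ?b" using v by (simp add: Y.m_assoc)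
  moreover have "?b \<otimes>\<^bsub>Y\<^esub> ?s \<in> carrier Y" using v by simp
  ultimately have "?b \<otimes>\<^bsub>Y\<^esub> ?s = \<one>\<^bsub>Y\<^esub>"
    using cancel v(2) unfolding one_cancellative_def by blast
  with sb gb gs show "g \<in> dom b \<and> ginv G g \<in> dom s \<and> ?s \<otimes>\<^bsub>Y\<^esub> ?b = \<one>\<^bsub>Y\<^esub> \<and> ?b \<otimes>\<^bsub>Y\<^esub> ?s = \<one>\<^bsub>Y\<^esub>"
    by blast
qed

text \<open>Since \<open>dom s\<close> is a bisection containing \<open>g\<inverse>\<close> for all \<open>g \<in> dom a\<close>, these inverses are the only
  elements of \<open>dom s\<close> composable with elements of \<open>dom a\<close>. Hence \<open>a s\<close> and \<open>s a\<close> live on units,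
  and both triple products can only live on \<open>dom a\<close>.\<close>

lemma dominated_via_if_inverts_on:
  assumes S: "a \<in> S" "b \<in> S" "s \<in> S" and inv: "inverts_on s b (dom a)"
  shows "dominated_via mul D s a b"
proof -
  note C = dom_carrier[OF S(1)] dom_carrier[OF S(2)] dom_carrier[OF S(3)]
  have i: "g \<in> dom b" "ginv G g \<in> dom s" "the (s (ginv G g)) \<otimes>\<^bsub>Y\<^esub> the (b g) = \<one>\<^bsub>Y\<^esub>"
    "the (b g) \<otimes>\<^bsub>Y\<^esub> the (s (ginv G g)) = \<one>\<^bsub>Y\<^esub>" "g \<in> carrier G"
    if "g \<in> dom a" for g
    using inv that subsetD[OF C(1)] by (simp_all add: inverts_on_def)
  have v: "the (s (ginv G g)) \<in> carrier Y" "the (b g) \<in> carrier Y" "the (a g) \<in> carrier Y"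
    if "g \<in> dom a" for g
    using value_closed[OF S(3) i(2)[OF that]] value_closed[OF S(2) i(1)[OF that]] value_closed[OF S(1) that] .
  have r: "t = ginv G g" if "g \<in> dom a" "t \<in> dom s" "src G g = rng G t" for g t
    using bisection_rng_inj[OF dom_bisection[OF S(3)] that(2) i(2)[OF that(1)]] that(3)
      rng_ginv[OF i(5)[OF that(1)]] by simp
  have l: "t = ginv G g" if "g \<in> dom a" "t \<in> dom s" "src G t = rng G g" for g t
    using bisection_src_inj[OF dom_bisection[OF S(3)] that(2) i(2)[OF that(1)]] that(3)
      src_ginv[OF i(5)[OF that(1)]] by simp
  have "dom (mul a s) \<subseteq> gunits G"
  proof
    fix k assume "k \<in> dom (mul a s)"
    then obtain g t where "g \<in> dom a" "t \<in> dom s" "src G g = rng G t" "k = g \<odot> t"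
      unfolding dom_pf_mult set_gmult_def by blast
    then show "k \<in> gunits G" using r[of g t] rng_in_gunits[OF i(5)] by (simp add: rng_def)
  qed
  then have as: "mul a s \<in> D" using mul_closed S by (simp add: diagonal_def)
  have "dom (mul s a) \<subseteq> gunits G"
  proof
    fix k assume "k \<in> dom (mul s a)"
    then obtain g t where "g \<in> dom a" "t \<in> dom s" "src G t = rng G g" "k = t \<odot> g"
      unfolding dom_pf_mult set_gmult_def by blast
    then show "k \<in> gunits G" using l[of g t] src_in_gunits[OF i(5)] by (simp add: src_def)
  qed
  then have sa: "mul s a \<in> D" using mul_closed S by (simp add: diagonal_def)
  have dom1: "k \<in> dom a" if "k \<in> dom (mul (mul a s) b)" for k
  proof -
    from that obtain g t h where gth: "g \<in> dom a" "t \<in> dom s" "src G g = rng G t" "h \<in> dom b"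
        "src G (g \<odot> t) = rng G h" "k = g \<odot> t \<odot> h"
      unfolding dom_pf_mult set_gmult_def by blast
    have gc: "g \<in> carrier G" using i(5) gth(1) .
    have gt: "g \<odot> t = rng G g" using r[OF gth(1-3)] by (simp add: rng_def)
    then have "rng G h = rng G g" using gth(5) src_rng[OF gc] by simp
    then have "h = g"
      using bisection_rng_inj[OF dom_bisection[OF S(2)] gth(4) i(1)[OF gth(1)]] by blast
    then show ?thesis using gth(1,6) gt rng_gmult_self[OF gc] by simp
  qed
  have dom2: "k \<in> dom a" if "k \<in> dom (mul (mul b s) a)" for k
  proof -
    from that obtain h t g where gth: "h \<in> dom b" "t \<in> dom s" "src G h = rng G t" "g \<in> dom a"
        "src G (h \<odot> t) = rng G g" "k = h \<odot> t \<odot> g"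
      unfolding dom_pf_mult set_gmult_def by blast
    have gc: "g \<in> carrier G" using i(5) gth(4) .
    have "(h, t) \<in> composable G" using gth(1-3) C by (auto simp: composable_def)
    then have "src G t = rng G g" using src_gmult gth(5) by simp
    then have t: "t = ginv G g" using l gth(2,4) by blast
    then have "src G h = src G g" using gth(3) rng_ginv[OF gc] by simp
    then have "h = g"
      using bisection_src_inj[OF dom_bisection[OF S(2)] gth(1) i(1)[OF gth(4)]] by blast
    then show ?thesis using gth(4,6) t rng_gmult_self[OF gc] by (simp add: rng_def)
  qed
  have val: "mul (mul a s) b g = a g" "mul (mul b s) a g = a g" if g: "g \<in> dom a" for g
  proof -
    note ig = i[OF g] and vg = v[OF g]
    have gs: "src G g = rng G (ginv G g)" using rng_ginv[OF ig(5)] by simp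
    have "mul a s (rng G g) = Some (the (a g) \<otimes>\<^bsub>Y\<^esub> the (s (ginv G g)))"
      and "mul b s (rng G g) = Some (the (b g) \<otimes>\<^bsub>Y\<^esub> the (s (ginv G g)))"
      using mul_apply[OF S(1,3) g ig(2) gs] mul_apply[OF S(2,3) ig(1,2) gs] by (simp_all add: rng_def)
    moreover from this have "rng G g \<in> dom (mul a s)" "rng G g \<in> dom (mul b s)" by blast+
    moreover have "src G (rng G g) = rng G g" "rng G g \<odot> g = g"
      using src_rng[OF ig(5)] rng_gmult_self[OF ig(5)] .
    ultimately have
      "mul (mul a s) b g = Some (the (a g) \<otimes>\<^bsub>Y\<^esub> the (s (ginv G g)) \<otimes>\<^bsub>Y\<^esub> the (b g))"
      "mul (mul b s) a g = Some (the (b g) \<otimes>\<^bsub>Y\<^esub> the (s (ginv G g)) \<otimes>\<^bsub>Y\<^esub> the (a g))"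
      using mul_apply[OF mul_closed[OF S(1,3)] S(2), of "rng G g" g]
        mul_apply[OF mul_closed[OF S(2,3)] S(1), of "rng G g" g] g ig(1)
      by simp_all
    then show "mul (mul a s) b g = a g" "mul (mul b s) a g = a g"
      using ig(3,4) vg g by (auto simp: Y.m_assoc)
  qed
  have "mul (mul a s) b k = a k" "mul (mul b s) a k = a k" for k
    using val[of k] dom1[of k] dom2[of k] by (metis domIff)+
  then have "mul (mul a s) b = a" "mul (mul b s) a = a" by (auto intro: ext)
  then show ?thesis using as sa by (simp add: dominated_via_def)
qed

lemma dominated_via_iff:
  assumes "a \<in> S" "b \<in> S" "s \<in> S"
  shows "dominated_via mul D s a b \<longleftrightarrow> inverts_on s b (dom a)"
  using inverts_on_if_dominated_via[OF assms] dominated_via_if_inverts_on[OF assms] by (rule iffI)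

lemma dominated_iff:
  assumes "a \<in> S" "b \<in> S"
  shows "dominated mul D S a b \<longleftrightarrow> (\<exists>s \<in> S. inverts_on s b (dom a))"
  using assms dominated_via_iff by (auto simp: dominated_def)

text \<open>Openness of \<open>N\<close> passes it from the set where \<open>b\<close> is invertible to the interior of that set.\<close>

lemma inverts_on_subset_usupp:
  assumes S: "b \<in> S" "s \<in> S" and inv: "inverts_on s b N" and N: "openin X N"
  shows "N \<subseteq> usupp b"
proof (rule interior_of_maximal[OF _ N])
  show "N \<subseteq> level_set (Units Y) b"
  proof
    fix g assume g: "g \<in> N"
    have gb: "g \<in> dom b" and gs: "ginv G g \<in> dom s" using inv g by (auto simp: inverts_on_def)
    show "g \<in> level_set (Units Y) b"
      using value_closed[OF S(1) gb] value_closed[OF S(2) gs] inv g gb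
      by (auto simp: inverts_on_def level_set_def Units_def)
  qed
qed

lemma dominated_subset_usupp:
  assumes "a \<in> S" "b \<in> S" "dominated mul D S a b"
  shows "dom a \<subseteq> usupp b"
proof -
  obtain s where "s \<in> S" "inverts_on s b (dom a)"
    using assms(3) unfolding dominated_iff[OF assms(1,2)] by blast
  then show ?thesis using inverts_on_subset_usupp[OF assms(2)] dom_open[OF assms(1)] by simp
qed

lemma dominated_subset_dom:
  assumes "a \<in> S" "b \<in> S" "dominated mul D S a b"
  shows "dom a \<subseteq> dom b"
  using dominated_subset_usupp[OF assms] usupp_subset_dom[of b] by (rule order_trans)

text \<open>(Involutive) describes a neighbourhood of \<open>g\<inverse>\<close>; continuity of inversion turns it into a
  neighbourhood of \<open>g\<close>.\<close>

lemma local_inverse: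
  assumes a: "a \<in> S" "g \<in> usupp a"
  obtains s N where "s \<in> S" "openin X N" "g \<in> N" "inverts_on s a N"
proof -
  obtain s where s: "s \<in> S" "ginv G g \<in> X interior_of {h \<in> carrier G. ginv G h \<in> dom a \<and> h \<in> dom s \<and>
          the (s h) \<in> Units Y \<and> the (a (ginv G h)) = inv\<^bsub>Y\<^esub> (the (s h))}" (is "_ \<in> X interior_of ?M")
    using involutive[OF a] .
  let ?N = "{x \<in> topspace X. ginv G x \<in> X interior_of ?M}"
  have "openin X ?N" using continuous_ginv by (simp add: continuous_map_def)
  moreover have "g \<in> ?N"
    using s(2) dom_carrier[OF a(1)] subsetD[OF usupp_subset_dom a(2)] by (auto simp: topspace_eq)
  moreover have "inverts_on s a ?N"
    unfolding inverts_on_def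
  proof
    fix x assume x: "x \<in> ?N"
    then have "ginv G x \<in> ?M" using interior_of_subset[of X ?M] by blast
    moreover have "ginv G (ginv G x) = x" using x by (simp add: topspace_eq ginv_ginv)
    ultimately show "x \<in> dom a \<and> ginv G x \<in> dom s \<and>
      the (s (ginv G x)) \<otimes>\<^bsub>Y\<^esub> the (a x) = \<one>\<^bsub>Y\<^esub> \<and> the (a x) \<otimes>\<^bsub>Y\<^esub> the (s (ginv G x)) = \<one>\<^bsub>Y\<^esub>"
      by simp
  qed
  ultimately show thesis using that s(1) by blast
qed

text \<open>The compact set is the image under \<open>src\<close> of the set where \<open>s b\<close> has value one. That set need not
  consist of units, but applying \<open>src\<close> moves it into the unit space, where the Hausdorff property
  is available.\<close>

lemma dominated_source_compact:
  assumes S: "a \<in> S" "b \<in> S" and dom: "dominated mul D S a b"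
  obtains K where "compactin (subtopology X (gunits G)) K" "src G ` dom a \<subseteq> K" "K \<subseteq> src G ` dom b"
proof -
  obtain s where s: "s \<in> S" "inverts_on s b (dom a)" 
    using dom unfolding dominated_iff[OF S] by blast
  let ?L = "level_set {\<one>\<^bsub>Y\<^esub>} (mul s b)"
  have "compactin (subtopology X (gunits G)) (src G ` ?L)"
    using image_compactin[OF one_compact[OF mul_closed[OF s(1) S(2)]] continuous_src] .
  moreover have "src G g \<in> src G ` ?L" if g: "g \<in> dom a" for g
  proof -
    have i: "g \<in> dom b" "ginv G g \<in> dom s" "the (s (ginv G g)) \<otimes>\<^bsub>Y\<^esub> the (b g) = \<one>\<^bsub>Y\<^esub>"
      and c: "g \<in> carrier G"
      using s(2) g dom_carrier[OF S(1)] by (auto simp: inverts_on_def)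
    have "mul s b (src G g) = Some \<one>\<^bsub>Y\<^esub>"
      using mul_apply[OF s(1) S(2) i(2,1)] i(3) src_ginv[OF c] by (simp add: src_def)
    then have "src G g \<in> ?L" by (simp add: level_set_def dom_def)
    then show ?thesis using src_src[OF c] by (metis imageI)
  qed
  moreover have "src G ` ?L \<subseteq> src G ` dom b"
  proof
    fix u assume "u \<in> src G ` ?L"
    then obtain k where "k \<in> dom (mul s b)" "u = src G k" by (auto simp: level_set_def)
    then obtain g h where gh: "g \<in> dom s" "h \<in> dom b" "src G g = rng G h" "u = src G (g \<odot> h)"
      by (auto simp: dom_pf_mult set_gmult_def)
    then have "(g, h) \<in> composable G" using dom_carrier S s by (auto simp: composable_def)
    then show "u \<in> src G ` dom b" using src_gmult gh by auto
  qed
  ultimately show thesis using that by blast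
qed

text \<open>The map \<open>src\<close> restricts to a homeomorphism on \<open>dom b\<close>, so the compact set between
  \<open>src G ` dom a\<close> and \<open>src G ` dom b\<close> lifts to a compact set between \<open>dom a\<close> and \<open>dom b\<close>.\<close>

lemma locally_compact: "locally_compact_nbhds X"
  unfolding locally_compact_nbhds_def neighbourhood_base_of
proof (intro allI impI)
  fix V g assume "openin X V \<and> g \<in> V"
  then obtain b where b: "b \<in> S" "dom b \<subseteq> V" "g \<in> usupp b" using urysohn[of V g] by blast
  obtain s N where s: "s \<in> S" "openin X N" "g \<in> N" "inverts_on s b N" using local_inverse[OF b(1,3)] .
  obtain a where a: "a \<in> S" "dom a \<subseteq> N" "g \<in> usupp a" using urysohn[OF s(2,3)] .
  have "dominated mul D S a b"
    unfolding dominated_iff[OF a(1) b(1)] using s(1) inverts_on_mono[OF s(4) a(2)] by blast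
  then obtain K where K: "compactin (subtopology X (gunits G)) K" "src G ` dom a \<subseteq> K" "K \<subseteq> src G ` dom b"
    using dominated_source_compact[OF a(1) b(1)] by blast
  have bb: "openin X (dom b)" "bisection G (dom b)" using b dom_open dom_bisection by auto
  let ?L = "{x \<in> dom b. src G x \<in> K}"
  have img: "src G ` ?L = K" using K(3) by blast
  have "compactin (subtopology (subtopology X (gunits G)) (src G ` dom b)) K"
    using K by (simp add: compactin_subtopology)
  then have "compactin (subtopology X (dom b)) ?L"
    using homeomorphic_map_compactness_eq[OF src_homeomorphic_on_bisection[OF bb]] img
      dom_carrier[OF b(1)] by (auto simp: topspace_eq)
  then have "compactin X ?L" by (simp add: compactin_subtopology)
  moreover have "dom a \<subseteq> ?L" using K(2) s(4) a(2) by (auto simp: inverts_on_def)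
  ultimately show "\<exists>U L. openin X U \<and> compactin X L \<and> g \<in> U \<and> U \<subseteq> L \<and> L \<subseteq> V"
    using dom_open[OF a(1)] subsetD[OF usupp_subset_dom a(3)] b(2)
    by (intro exI[of _ "dom a"] exI[of _ ?L]) auto
qed

section \<open>Ultrafilters are the germ sets\<close>

lemma germs_iff: "a \<in> germs g \<longleftrightarrow> a \<in> S \<and> g \<in> usupp a"
  by (simp add: germ_set_def)

lemma germs_subset: "germs g \<subseteq> S"
  by (auto simp: germ_set_def)

lemma germs_proper: "germs g \<noteq> S"
proof -
  have "Map.empty \<notin> germs g" using usupp_subset_dom[of Map.empty] by (simp add: germs_iff)
  then show ?thesis using empty_in by blast
qed

text \<open>Closure downwards: on the intersection of two open sets where \<open>a\<close> and \<open>b\<close> have local inverses,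
  (Urysohn) provides an element dominated by both.\<close>

lemma germs_filter:
  assumes "g \<in> carrier G"
  shows "dom_filter mul D S (germs g)"
  unfolding dom_filter_def
proof (intro conjI ballI iffI)
  have "g \<in> topspace X" using assms by (simp add: topspace_eq)
  then obtain a where "a \<in> S" "g \<in> usupp a" using urysohn[OF openin_topspace] by metis
  then show "germs g \<noteq> {}" using germs_iff by blast
  show "germs g \<subseteq> S" by (rule germs_subset)
next
  fix a b assume S: "a \<in> S" "b \<in> S" and "a \<in> germs g \<and> b \<in> germs g"
  then have ab: "g \<in> usupp a" "g \<in> usupp b" by (auto simp: germs_iff)
  obtain s N where s: "s \<in> S" "openin X N" "g \<in> N" "inverts_on s a N" using local_inverse[OF S(1) ab(1)] .
  obtain t M where t: "t \<in> S" "openin X M" "g \<in> M" "inverts_on t b M" using local_inverse[OF S(2) ab(2)] .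
  obtain c where c: "c \<in> S" "dom c \<subseteq> N \<inter> M" "g \<in> usupp c"
    using urysohn[of "N \<inter> M" g] s t by blast
  have "dominated mul D S c a"
    unfolding dominated_iff[OF c(1) S(1)] using inverts_on_mono[OF s(4), of "dom c"] s(1) c(2) by blast
  moreover have "dominated mul D S c b"
    unfolding dominated_iff[OF c(1) S(2)] using inverts_on_mono[OF t(4), of "dom c"] t(1) c(2) by blast
  moreover have "c \<in> germs g" using c by (simp add: germs_iff)
  ultimately show "\<exists>c \<in> germs g. dominated mul D S c a \<and> dominated mul D S c b" by blast
next
  fix a b assume S: "a \<in> S" "b \<in> S"
  assume "\<exists>c \<in> germs g. dominated mul D S c a \<and> dominated mul D S c b"
  then obtain c where c: "c \<in> S" "g \<in> usupp c" "dominated mul D S c a" "dominated mul D S c b"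
    by (auto simp: germs_iff)
  have "g \<in> dom c" using subsetD[OF usupp_subset_dom c(2)] .
  then show "a \<in> germs g" "b \<in> germs g"
    using dominated_subset_usupp[OF c(1) S(1) c(3)] dominated_subset_usupp[OF c(1) S(2) c(4)] S
    by (auto simp: germs_iff)
qed

lemma filter_down:
  assumes "dom_filter mul D S F" "a \<in> F" "b \<in> F"
  obtains c where "c \<in> F" "c \<in> S" "dominated mul D S c a" "dominated mul D S c b"
proof -
  have "a \<in> S" "b \<in> S" and FS: "F \<subseteq> S"
    and "\<forall>a \<in> S. \<forall>b \<in> S. a \<in> F \<and> b \<in> F \<longleftrightarrow> (\<exists>c \<in> F. dominated mul D S c a \<and> dominated mul D S c b)"
    using assms by (auto simp: dom_filter_def)
  then have "\<exists>c \<in> F. dominated mul D S c a \<and> dominated mul D S c b"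
    using assms(2,3) by blast
  then show thesis using that FS by blast
qed

text \<open>The empty function is dominated by every element, so a filter containing it is all of \<open>S\<close>.\<close>

lemma proper_filter_nonempty_dom:
  assumes F: "dom_filter mul D S F" "F \<noteq> S" and c: "c \<in> F"
  shows "dom c \<noteq> {}"
proof
  assume "dom c = {}"
  then have c0: "c = Map.empty" by auto
  have "a \<in> F" if a: "a \<in> S" for a
  proof -
    have "dominated mul D S c a"
      using a empty_in c0 by (auto simp: dominated_iff inverts_on_def)
    moreover have "\<forall>a \<in> S. \<forall>b \<in> S.
        a \<in> F \<and> b \<in> F \<longleftrightarrow> (\<exists>c \<in> F. dominated mul D S c a \<and> dominated mul D S c b)"
      using F(1) by (simp add: dom_filter_def)
    ultimately show ?thesis using a c by blast
  qed
  then show False using F by (auto simp: dom_filter_def)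
qed

text \<open>The sets \<open>src G ` dom c\<close> with \<open>c\<close> in the filter are nonempty and directed downwards. Sandwiching
  compact, hence closed, sets between them yields a unit in all of them.\<close>

lemma proper_filter_subset_germs:
  assumes F: "dom_filter mul D S F" "F \<noteq> S"
  obtains g where "g \<in> carrier G" "F \<subseteq> germs g"
proof -
  let ?Z = "subtopology X (gunits G)"
  have FS: "F \<subseteq> S" and "F \<noteq> {}" using F by (auto simp: dom_filter_def)
  \<comment> \<open>Compact sets of units that are large enough to contain the sources of a filter element; by
     domination each \<open>src G ` dom b\<close> contains one of them.\<close>
  define \<K> where "\<K> = {K. compactin ?Z K \<and> (\<exists>c \<in> F. src G ` dom c \<subseteq> K)}"
  have below: "\<exists>c \<in> F. src G ` dom c \<subseteq> \<Inter>\<F>" if "finite \<F>" "\<F> \<subseteq> \<K>" for \<F>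
    using that
  proof (induction \<F>)
    case empty
    then show ?case using \<open>F \<noteq> {}\<close> by auto
  next
    case (insert K \<F>)
    then obtain c where c: "c \<in> F" "src G ` dom c \<subseteq> \<Inter>\<F>" by auto
    obtain d where d: "d \<in> F" "src G ` dom d \<subseteq> K" using insert.prems by (auto simp: \<K>_def)
    obtain e where e: "e \<in> F" "e \<in> S" "dominated mul D S e c" "dominated mul D S e d"
      using filter_down[OF F(1) c(1) d(1)] .
    have "dom e \<subseteq> dom c" "dom e \<subseteq> dom d"
      using dominated_subset_dom[OF e(2) _ e(3)] dominated_subset_dom[OF e(2) _ e(4)] c(1) d(1) FS
      by auto
    then have "src G ` dom e \<subseteq> \<Inter>(insert K \<F>)" using c(2) d(2) by blast
    then show ?case using e(1) by blast
  qed
  have base: "\<exists>K \<in> \<K>. K \<subseteq> src G ` dom b" if b: "b \<in> F" for b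
  proof -
    obtain c where c: "c \<in> F" "c \<in> S" "dominated mul D S c b" using filter_down[OF F(1) b b] .
    obtain K where "compactin ?Z K" "src G ` dom c \<subseteq> K" "K \<subseteq> src G ` dom b"
      using dominated_source_compact[OF c(2) _ c(3)] b FS by blast
    then show ?thesis using c(1) unfolding \<K>_def by blast
  qed
  obtain b0 where "b0 \<in> F" using \<open>F \<noteq> {}\<close> by blast
  then obtain K0 where K0: "K0 \<in> \<K>" using base by blast
  have "\<forall>C \<in> \<K>. closedin ?Z C"
    using compactin_imp_closedin[OF Hausdorff_units] by (auto simp: \<K>_def)
  moreover have "K0 \<inter> \<Inter>\<F> \<noteq> {}" if "finite \<F>" "\<F> \<subseteq> \<K>" for \<F>
    using below[of "insert K0 \<F>"] that K0 proper_filter_nonempty_dom[OF F] by fastforce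
  moreover have "compactin ?Z K0" using K0 by (simp add: \<K>_def)
  ultimately have "K0 \<inter> \<Inter>\<K> \<noteq> {}" unfolding compactin_fip by blast
  then obtain x where x: "x \<in> \<Inter>\<K>" by blast
  have lift: "\<exists>g \<in> dom b. src G g = x" if "b \<in> F" for b
    using base[OF that] x by blast
  obtain g where g: "g \<in> dom b0" "src G g = x" using lift[OF \<open>b0 \<in> F\<close>] by blast
  \<comment> \<open>Points over \<open>x\<close> in different domains agree, as a common lower bound also has a point over \<open>x\<close>.\<close>
  have common: "g \<in> dom b" if b: "b \<in> F" for b
  proof -
    obtain c where c: "c \<in> F" "c \<in> S" "dominated mul D S c b0" "dominated mul D S c b"
      using filter_down[OF F(1) \<open>b0 \<in> F\<close> b] .
    have sub: "dom c \<subseteq> dom b0" "dom c \<subseteq> dom b"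
      using dominated_subset_dom[OF c(2) _ c(3)] dominated_subset_dom[OF c(2) _ c(4)] b \<open>b0 \<in> F\<close> FS
      by auto
    obtain h where h: "h \<in> dom c" "src G h = x" using lift[OF c(1)] by blast
    have "h = g"
      using bisection_src_inj[OF dom_bisection, of b0 h g] \<open>b0 \<in> F\<close> FS h g sub(1) by auto
    then show ?thesis using h sub by blast
  qed
  have "b \<in> germs g" if b: "b \<in> F" for b
  proof -
    obtain c where c: "c \<in> F" "c \<in> S" "dominated mul D S c b" using filter_down[OF F(1) b b] .
    have "b \<in> S" using b FS by blast
    then show ?thesis
      using dominated_subset_usupp[OF c(2) _ c(3)] common[OF c(1)] by (auto simp: germs_iff)
  qed
  moreover have "g \<in> carrier G" using g dom_carrier \<open>b0 \<in> F\<close> FS by blast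
  ultimately show thesis using that by blast
qed

text \<open>The inclusion says that every neighbourhood of \<open>g\<close> contains \<open>h\<close>. As \<open>src\<close> is continuous, the
  sources cannot be separated, so they coincide; and \<open>g\<close>, \<open>h\<close> lie in a common bisection.\<close>

lemma germs_inclusion_imp_eq:
  assumes g: "g \<in> carrier G" and h: "h \<in> carrier G" and sub: "germs g \<subseteq> germs h"
  shows "g = h"
proof -
  have nbhd: "h \<in> V" if "openin X V" "g \<in> V" for V
  proof -
    obtain a where "a \<in> S" "dom a \<subseteq> V" "g \<in> usupp a"
      using urysohn[OF \<open>openin X V\<close> \<open>g \<in> V\<close>] .
    then have "h \<in> usupp a" using sub by (auto simp: germs_iff)
    then show ?thesis using subsetD[OF usupp_subset_dom] \<open>dom a \<subseteq> V\<close> by blast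
  qed
  have "src G g = src G h"
  proof (rule ccontr)
    assume "src G g \<noteq> src G h"
    then obtain U V where UV: "openin (subtopology X (gunits G)) U" "openin (subtopology X (gunits G)) V"
        "src G g \<in> U" "src G h \<in> V" "disjnt U V"
      using Hausdorff_units src_in_gunits[OF g] src_in_gunits[OF h] gunits_subset
      unfolding Hausdorff_space_def by (metis inf.absorb2 topspace_eq topspace_subtopology)
    have "openin X {x \<in> topspace X. src G x \<in> U}"
      using continuous_src UV(1) by (simp add: continuous_map_def)
    moreover have "g \<in> {x \<in> topspace X. src G x \<in> U}" using UV(3) g by (simp add: topspace_eq)
    ultimately have "src G h \<in> U" using nbhd by blast
    then show False using UV by (auto simp: disjnt_def)
  qed
  moreover obtain B where B: "openin X B" "bisection G B" "g \<in> B"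
    using exists_open_bisection[OF openin_topspace, of g] g by (auto simp: topspace_eq)
  ultimately show ?thesis using bisection_src_inj[OF B(2,3)] nbhd[OF B(1,3)] by blast
qed

lemma ultrafilters_eq: "ultrafilters mul D S = germs ` carrier G"
proof (intro equalityI subsetI)
  fix U assume "U \<in> ultrafilters mul D S"
  then have U: "dom_filter mul D S U" "U \<noteq> S"
    "\<And>F. dom_filter mul D S F \<Longrightarrow> F \<noteq> S \<Longrightarrow> U \<subseteq> F \<Longrightarrow> F = U"
    by (auto simp: ultrafilters_def)
  obtain g where g: "g \<in> carrier G" "U \<subseteq> germs g" using proper_filter_subset_germs[OF U(1,2)] .
  then show "U \<in> germs ` carrier G"
    using U(3)[OF germs_filter[OF g(1)] germs_proper g(2)] g(1) by blast
next
  fix U assume "U \<in> germs ` carrier G"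
  then obtain g where g: "g \<in> carrier G" "U = germs g" by blast
  have max: "F = germs g" if F: "dom_filter mul D S F" "F \<noteq> S" "germs g \<subseteq> F" for F
  proof -
    obtain h where h: "h \<in> carrier G" "F \<subseteq> germs h" using proper_filter_subset_germs[OF F(1,2)] .
    then have "g = h" using germs_inclusion_imp_eq g F by blast
    then show ?thesis using h F by blast
  qed
  show "U \<in> ultrafilters mul D S"
    unfolding ultrafilters_def mem_Collect_eq g(2)
    by (intro conjI allI impI germs_filter[OF g(1)] germs_proper) (elim conjE, rule max)
qed

lemma topspace_ultrafilter_topology:
  "topspace (ultrafilter_topology mul D S) = ultrafilters mul D S"
proof -
  have "\<exists>a \<in> S. a \<in> U" if "U \<in> ultrafilters mul D S" for U
  proof -
    have "U \<noteq> {}" "U \<subseteq> S" using that by (simp_all add: ultrafilters_def dom_filter_def)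
    then show ?thesis by blast
  qed
  then show ?thesis by (auto simp: ultrafilter_topology_def)
qed

text \<open>The points whose germ set contains \<open>a\<close> form the open set where \<open>a\<close> is invertible. These sets are
  a base of \<open>G\<close> by (Urysohn), and their images generate the topology of the ultrafilters.\<close>

theorem germs_homeomorphic: "homeomorphic_map X (ultrafilter_topology mul D S) germs"
proof (rule bijective_open_imp_homeomorphic_map)
  let ?U = "\<lambda>a. {U \<in> ultrafilters mul D S. a \<in> U}"
  show surj: "germs ` topspace X = topspace (ultrafilter_topology mul D S)"
    by (simp add: topspace_ultrafilter_topology ultrafilters_eq topspace_eq)
  show inj: "inj_on germs (topspace X)"
    using germs_inclusion_imp_eq by (auto simp: inj_on_def topspace_eq)
  have img: "germs ` usupp a = ?U a" if "a \<in> S" for a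
    using that usupp_subset_dom[of a] dom_carrier[OF that] by (auto simp: ultrafilters_eq germs_iff)
  show "continuous_map X (ultrafilter_topology mul D S) germs"
    unfolding ultrafilter_topology_def
  proof (rule continuous_on_generated_topo)
    fix W assume "W \<in> ?U ` S"
    then obtain a where a: "a \<in> S" "W = ?U a" by blast
    have "germs -` W \<inter> topspace X = usupp a"
      using a usupp_subset_dom[of a] dom_carrier[OF a(1)]
      by (auto simp: ultrafilters_eq germs_iff topspace_eq)
    then show "openin X (germs -` W \<inter> topspace X)" by simp
  next
    show "germs ` topspace X \<subseteq> \<Union> (?U ` S)"
      using surj by (simp add: ultrafilter_topology_def)
  qed
  show "open_map X (ultrafilter_topology mul D S) germs"
    unfolding open_map_def
  proof (intro allI impI)
    fix V assume V: "openin X V"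
    show "openin (ultrafilter_topology mul D S) (germs ` V)"
    proof (subst openin_subopen, intro ballI)
      fix U assume "U \<in> germs ` V"
      then obtain g where g: "g \<in> V" "U = germs g" by blast
      obtain a where a: "a \<in> S" "dom a \<subseteq> V" "g \<in> usupp a" using urysohn[OF V g(1)] .
      have "openin (ultrafilter_topology mul D S) (?U a)"
        unfolding ultrafilter_topology_def using a(1) by (intro topology_generated_by_Basis) blast
      then have "openin (ultrafilter_topology mul D S) (germs ` usupp a)"
        using img[OF a(1)] by simp
      then show "\<exists>T. openin (ultrafilter_topology mul D S) T \<and> U \<in> T \<and> T \<subseteq> germs ` V"
        using g a(3) order_trans[OF usupp_subset_dom a(2)]
        by (intro exI[of _ "germs ` usupp a"]) (simp add: image_mono)
    qed
  qed
qed

section \<open>The groupoid of ultrafilters\<close>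

text \<open>A local inverse of \<open>s\<close> near \<open>g\<inverse>\<close> is an element that \<open>s\<close> inverts near \<open>g\<close>, which is the symmetry
  behind both inclusions.\<close>

lemma germs_ginv:
  assumes g: "g \<in> carrier G"
  shows "germs (ginv G g) = star mul D S (germs g)"
proof (intro equalityI subsetI)
  fix s assume "s \<in> germs (ginv G g)"
  then have s: "s \<in> S" "ginv G g \<in> usupp s" by (auto simp: germs_iff)
  obtain r N where r: "r \<in> S" "openin X N" "ginv G g \<in> N" "inverts_on r s N"
    using local_inverse[OF s] .
  have N: "N \<subseteq> carrier G" using r(2) openin_subset topspace_eq by metis
  have "g \<in> ginv G ` N" using r(3) ginv_ginv[OF g] by force
  then obtain t where t: "t \<in> S" "dom t \<subseteq> ginv G ` N" "g \<in> usupp t"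
    using urysohn[OF openin_ginv_image[OF r(2)]] by blast
  have "inverts_on s r (ginv G ` N)"
    using r(4) N by (auto simp: inverts_on_def ginv_ginv subset_iff)
  then have "dominated_via mul D s t r"
    unfolding dominated_via_iff[OF t(1) r(1) s(1)] using t(2) by (rule inverts_on_mono)
  moreover have "t \<in> germs g" using t by (simp add: germs_iff)
  ultimately show "s \<in> star mul D S (germs g)"
    using s(1) r(1) unfolding star_def by blast
next
  fix s assume "s \<in> star mul D S (germs g)"
  then obtain t r where tr: "s \<in> S" "t \<in> S" "r \<in> S" "g \<in> usupp t" "dominated_via mul D s t r"
    by (auto simp: star_def germs_iff)
  have i: "inverts_on s r (dom t)" using tr(5) dominated_via_iff[OF tr(2,3,1)] by simp
  have "inverts_on r s (ginv G ` dom t)"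
    using i dom_carrier[OF tr(2)] by (fastforce simp: inverts_on_def ginv_ginv)
  then have "ginv G ` dom t \<subseteq> usupp s"
    using inverts_on_subset_usupp[OF tr(1,3)] openin_ginv_image[OF dom_open[OF tr(2)]] by blast
  then show "s \<in> germs (ginv G g)"
    using tr(1) subsetD[OF usupp_subset_dom tr(4)] by (auto simp: germs_iff)
qed

text \<open>If \<open>a\<close> has a local inverse near \<open>g h\<close>, continuity of multiplication gives \<open>t\<close> and \<open>t'\<close> around
  \<open>g\<close> and \<open>h\<close> with \<open>dom (t t')\<close> inside that neighbourhood, and the domain alone decides domination.\<close>

lemma germs_gmult:
  assumes gh: "(g, h) \<in> composable G"
  shows "germs (g \<odot> h) = up_closure mul D S (set_mult mul (germs g) (germs h))"
proof (intro equalityI subsetI)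
  fix a assume "a \<in> germs (g \<odot> h)"
  then have a: "a \<in> S" "g \<odot> h \<in> usupp a" by (auto simp: germs_iff)
  obtain s N where s: "s \<in> S" "openin X N" "g \<odot> h \<in> N" "inverts_on s a N"
    using local_inverse[OF a] .
  obtain A B where AB: "openin X A" "openin X B" "g \<in> A" "h \<in> B" "set_gmult G A B \<subseteq> N"
    using gmult_neighbourhoods[OF gh s(2,3)] .
  obtain t where t: "t \<in> S" "dom t \<subseteq> A" "g \<in> usupp t" using urysohn[OF AB(1,3)] .
  obtain t' where t': "t' \<in> S" "dom t' \<subseteq> B" "h \<in> usupp t'" using urysohn[OF AB(2,4)] .
  have "dom (mul t t') \<subseteq> N"
    unfolding dom_pf_mult using set_gmult_mono[OF t(2) t'(2)] AB(5) by simp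
  then have "dominated mul D S (mul t t') a"
    unfolding dominated_iff[OF mul_closed[OF t(1) t'(1)] a(1)]
    using s(1) inverts_on_mono[OF s(4)] by blast
  moreover have "t \<in> germs g" "t' \<in> germs h" using t t' by (simp_all add: germs_iff)
  ultimately show "a \<in> up_closure mul D S (set_mult mul (germs g) (germs h))"
    using a(1) unfolding up_closure_def set_mult_def by blast
next
  fix a assume "a \<in> up_closure mul D S (set_mult mul (germs g) (germs h))"
  then obtain t t' where t: "a \<in> S" "t \<in> S" "t' \<in> S" "g \<in> usupp t" "h \<in> usupp t'"
      "dominated mul D S (mul t t') a"
    by (auto simp: up_closure_def set_mult_def germs_iff)
  have "g \<odot> h \<in> dom (mul t t')"
    unfolding dom_pf_mult
    using subsetD[OF usupp_subset_dom t(4)] subsetD[OF usupp_subset_dom t(5)] gh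
    by (intro set_gmultI) (auto simp: composable_def)
  then show "a \<in> germs (g \<odot> h)"
    using dominated_subset_usupp[OF mul_closed[OF t(2,3)] t(1,6)] t(1) by (auto simp: germs_iff)
qed

end

text \<open>Only products of composable pairs are compared, because the product of a groupoid has arbitrary
  values elsewhere. That suffices: sources and ranges are such products, so composability is
  transported as well.\<close>

lemma etale_groupoid_transport:
  assumes et: "etale_groupoid G X" and f: "homeomorphic_map X Z f"
    and carrier: "carrier H = topspace Z"
    and ginv: "\<And>g. g \<in> carrier G \<Longrightarrow> ginv H (f g) = f (ginv G g)"
    and gmult: "\<And>g h. (g, h) \<in> composable G \<Longrightarrow> f g \<odot>\<^bsub>H\<^esub> f h = f (g \<odot>\<^bsub>G\<^esub> h)"
  shows "etale_groupoid H Z"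
    and "\<And>g h. g \<in> carrier G \<Longrightarrow> h \<in> carrier G \<Longrightarrow>
      (f g, f h) \<in> composable H \<longleftrightarrow> (g, h) \<in> composable G"
proof -
  interpret groupoid G using et by (simp add: etale_groupoid_def)
  have top: "topspace X = carrier G"
    and cinv: "continuous_map X X (ginv G)"
    and cmult: "continuous_map (subtopology (prod_topology X X) (composable G)) X (\<lambda>(g, h). g \<odot>\<^bsub>G\<^esub> h)"
    and units_open: "openin X (gunits G)"
    and lh: "local_homeomorphism X (subtopology X (gunits G)) (src G)"
    using et by (auto simp: etale_groupoid_def)
  have img: "carrier H = f ` carrier G"
    using homeomorphic_imp_surjective_map[OF f] top carrier by simp
  have inj: "f g = f h \<longleftrightarrow> g = h" if "g \<in> carrier G" "h \<in> carrier G" for g h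
    using homeomorphic_imp_injective_map[OF f] that top by (auto simp: inj_on_def)
  have src: "src H (f g) = f (src G g)" and rng: "rng H (f g) = f (rng G g)"
    if "g \<in> carrier G" for g
    using that by (simp_all add: src_def rng_def ginv gmult ginv_composable)
  show comp: "(f g, f h) \<in> composable H \<longleftrightarrow> (g, h) \<in> composable G"
    if "g \<in> carrier G" "h \<in> carrier G" for g h
    using that by (auto simp: composable_def img src rng inj src_closed rng_closed)
  have compH: "\<exists>g h. p = (f g, f h) \<and> (g, h) \<in> composable G" if "p \<in> composable H" for p
  proof -
    have "fst p \<in> f ` carrier G" "snd p \<in> f ` carrier G"
      using that img by (auto simp: composable_def)
    then obtain g h where gh: "fst p = f g" "snd p = f h" "g \<in> carrier G" "h \<in> carrier G" by blast
    then have "p = (f g, f h)" by (simp add: prod_eq_iff)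
    then show ?thesis using comp[OF gh(3,4)] that by blast
  qed
  have units: "gunits H = f ` gunits G"
    unfolding gunits_def img by (force simp: src image_image)
  have grp: "groupoid H"
  proof
    show "ginv H u \<in> carrier H" if "u \<in> carrier H" for u
      using that by (auto simp: img ginv ginv_closed)
    show "ginv H (ginv H u) = u" if "u \<in> carrier H" for u
      using that by (auto simp: img ginv ginv_closed ginv_ginv)
    show "u \<odot>\<^bsub>H\<^esub> v \<in> carrier H" if "(u, v) \<in> composable H" for u v
      using compH[OF that] by (auto simp: img gmult gmult_closed)
    show "src H (u \<odot>\<^bsub>H\<^esub> v) = src H v" if "(u, v) \<in> composable H" for u v
      using compH[OF that] by (auto simp: gmult gmult_closed src src_gmult composable_def)
    show "rng H (u \<odot>\<^bsub>H\<^esub> v) = rng H u" if "(u, v) \<in> composable H" for u v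
      using compH[OF that] by (auto simp: gmult gmult_closed rng rng_gmult composable_def)
    show "u \<odot>\<^bsub>H\<^esub> v \<odot>\<^bsub>H\<^esub> w = u \<odot>\<^bsub>H\<^esub> (v \<odot>\<^bsub>H\<^esub> w)"
      if uvw: "(u, v) \<in> composable H" "(v, w) \<in> composable H" for u v w
    proof -
      obtain g h where gh: "u = f g" "v = f h" "(g, h) \<in> composable G" using compH[OF uvw(1)] by auto
      obtain k where k: "w = f k" "k \<in> carrier G"
        using uvw(2) img by (auto simp: composable_def)
      have hk: "(h, k) \<in> composable G" 
        using comp[of h k] uvw(2) gh k by (auto simp: composable_def)
      have "(g \<odot>\<^bsub>G\<^esub> h, k) \<in> composable G" "(g, h \<odot>\<^bsub>G\<^esub> k) \<in> composable G"
        using gh(3) hk by (auto simp: composable_def gmult_closed src_gmult rng_gmult)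
      then show ?thesis using gh k hk by (simp add: gmult gmult_assoc)
    qed
    show "ginv H u \<odot>\<^bsub>H\<^esub> (u \<odot>\<^bsub>H\<^esub> v) = v" if uv: "(u, v) \<in> composable H" for u v
    proof -
      obtain g h where gh: "u = f g" "v = f h" "(g, h) \<in> composable G" using compH[OF uv] by auto
      moreover from gh(3) have "(ginv G g, g \<odot>\<^bsub>G\<^esub> h) \<in> composable G" "g \<in> carrier G"
        by (auto simp: composable_def gmult_closed rng_gmult src_ginv ginv_closed)
      ultimately show ?thesis by (simp add: gmult ginv ginv_gmult_cancel)
    qed
    show "u \<odot>\<^bsub>H\<^esub> v \<odot>\<^bsub>H\<^esub> ginv H v = u" if uv: "(u, v) \<in> composable H" for u v
    proof -
      obtain g h where gh: "u = f g" "v = f h" "(g, h) \<in> composable G" using compH[OF uv] by auto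
      moreover from gh(3) have "(g \<odot>\<^bsub>G\<^esub> h, ginv G h) \<in> composable G" "h \<in> carrier G"
        by (auto simp: composable_def gmult_closed src_gmult rng_ginv ginv_closed)
      ultimately show ?thesis by (simp add: gmult ginv gmult_ginv_cancel)
    qed
  qed
  obtain f' where maps: "homeomorphic_maps X Z f f'" using f homeomorphic_map_maps by blast
  then have cf: "continuous_map X Z f" and cf': "continuous_map Z X f'"
    and f'f: "\<And>x. x \<in> carrier G \<Longrightarrow> f' (f x) = x"
    by (auto simp: homeomorphic_maps_def top)
  have hf': "homeomorphic_map Z X f'" using maps homeomorphic_maps_map by blast
  have "continuous_map Z Z (ginv H)"
  proof (rule continuous_map_eq)
    show "continuous_map Z Z (f \<circ> ginv G \<circ> f')"
      using continuous_map_compose[OF cf' continuous_map_compose[OF cinv cf]] .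
    show "(f \<circ> ginv G \<circ> f') z = ginv H z" if z: "z \<in> topspace Z" for z
    proof -
      obtain g where "g \<in> carrier G" "z = f g" using z carrier img by auto
      then show ?thesis by (simp add: f'f ginv)
    qed
  qed
  moreover have "continuous_map (subtopology (prod_topology Z Z) (composable H)) Z (\<lambda>(u, v). u \<odot>\<^bsub>H\<^esub> v)"
    (is "continuous_map ?P Z _")
  proof (rule continuous_map_eq)
    have "continuous_map ?P (subtopology (prod_topology X X) (composable G)) (\<lambda>(u, v). (f' u, f' v))"
    proof -
      have "continuous_map (prod_topology Z Z) (prod_topology X X) (\<lambda>(u, v). (f' u, f' v))"
        using cf' by (simp add: continuous_map_prod_top)
      moreover have "(f' u, f' v) \<in> composable G" if "(u, v) \<in> composable H" for u v
        using compH[OF that] by (auto simp: composable_def f'f)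
      ultimately show ?thesis
        by (auto simp: continuous_map_in_subtopology continuous_map_from_subtopology)
    qed
    from continuous_map_compose[OF continuous_map_compose[OF this cmult] cf]
    show "continuous_map ?P Z (f \<circ> ((\<lambda>(g, h). g \<odot>\<^bsub>G\<^esub> h) \<circ> (\<lambda>(u, v). (f' u, f' v))))" .
    show "(f \<circ> ((\<lambda>(g, h). g \<odot>\<^bsub>G\<^esub> h) \<circ> (\<lambda>(u, v). (f' u, f' v)))) p = (\<lambda>(u, v). u \<odot>\<^bsub>H\<^esub> v) p"
      if "p \<in> topspace ?P" for p
    proof -
      from that have "p \<in> composable H" by simp
      then obtain g h where gh: "p = (f g, f h)" "(g, h) \<in> composable G" using compH by blast
      then have "g \<in> carrier G" "h \<in> carrier G" by (auto simp: composable_def)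
      with gh show ?thesis by (simp add: f'f gmult)
    qed
  qed
  moreover have "openin Z (gunits H)"
    using units units_open homeomorphic_map_openness_eq[OF f] by auto
  moreover have "local_homeomorphism Z (subtopology Z (gunits H)) (src H)"
    unfolding local_homeomorphism_def
  proof (intro conjI ballI)
    show "src H ` topspace Z \<subseteq> topspace (subtopology Z (gunits H))"
      using groupoid.src_in_gunits[OF grp] groupoid.src_closed[OF grp] carrier by auto
    fix z assume "z \<in> topspace Z"
    then obtain x where x: "x \<in> carrier G" "z = f x" using carrier img by auto
    let ?X0 = "subtopology X (gunits G)" and ?Z0 = "subtopology Z (gunits H)"
    obtain U where U: "openin X U" "x \<in> U" "openin ?X0 (src G ` U)"
      "homeomorphic_map (subtopology X U) (subtopology ?X0 (src G ` U)) (src G)"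
      using lh x(1) top unfolding local_homeomorphism_def by metis
    have Uc: "U \<subseteq> carrier G" using U(1) openin_subset top by metis
    have srcU: "src H ` f ` U = f ` src G ` U" using Uc src by (force simp: image_image)
    have sU: "src G ` U \<subseteq> gunits G" using Uc src_in_gunits by blast
    have f0: "homeomorphic_map ?X0 ?Z0 f"
      using homeomorphic_map_subtopologies[OF f, of "gunits G" "gunits H"] units top carrier
        gunits_subset groupoid.gunits_subset[OF grp] by (simp add: Int_absorb1)
    have "homeomorphic_map (subtopology ?X0 (src G ` U)) (subtopology ?Z0 (f ` src G ` U)) f"
    proof (rule homeomorphic_map_subtopologies[OF f0])
      have "src G ` U \<subseteq> topspace ?X0" using sU gunits_subset top by auto
      moreover have "f ` src G ` U \<subseteq> topspace ?Z0"
        using calculation homeomorphic_imp_surjective_map[OF f0] by blast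
      ultimately show "f ` (topspace ?X0 \<inter> src G ` U) = topspace ?Z0 \<inter> f ` src G ` U"
        by (simp add: Int_absorb1)
    qed
    moreover have "homeomorphic_map (subtopology Z (f ` U)) (subtopology X U) f'"
    proof (rule homeomorphic_map_subtopologies[OF hf'])
      have "f' ` f ` U = U" using Uc f'f by (force simp: image_image)
      moreover have "f ` U \<subseteq> topspace Z" using Uc carrier img by auto
      ultimately show "f' ` (topspace Z \<inter> f ` U) = topspace X \<inter> U"
        using Uc top by (simp add: Int_absorb1)
    qed
    ultimately have "homeomorphic_map (subtopology Z (f ` U)) (subtopology ?Z0 (f ` src G ` U)) (f \<circ> (src G \<circ> f'))"
      by (intro homeomorphic_map_compose[OF homeomorphic_map_compose[OF _ U(4)]])
    then have "homeomorphic_map (subtopology Z (f ` U)) (subtopology ?Z0 (src H ` f ` U)) (src H)"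
      unfolding srcU
    proof (rule homeomorphic_map_eq)
      show "(f \<circ> (src G \<circ> f')) w = src H w" if "w \<in> topspace (subtopology Z (f ` U))" for w
        using that Uc by (auto simp: f'f src subset_iff)
    qed
    moreover have "openin Z (f ` U)" "z \<in> f ` U"
      using U x homeomorphic_map_openness_eq[OF f] by auto
    moreover have "openin ?Z0 (src H ` f ` U)"
      unfolding srcU using U(3) homeomorphic_map_openness_eq[OF f0] by blast
    ultimately show "\<exists>U. openin Z U \<and> z \<in> U \<and> openin ?Z0 (src H ` U) \<and>
        homeomorphic_map (subtopology Z U) (subtopology ?Z0 (src H ` U)) (src H)"
      by blast
  qed
  ultimately show "etale_groupoid H Z"
    using grp carrier by (simp add: etale_groupoid_def)
qed

lemma locally_compact_nbhds_transport:
  assumes f: "homeomorphic_map X Z f" and X: "locally_compact_nbhds X"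
  shows "locally_compact_nbhds Z"
  unfolding locally_compact_nbhds_def neighbourhood_base_of
proof (intro allI impI)
  fix W z assume W: "openin Z W \<and> z \<in> W"
  let ?W = "{x \<in> topspace X. f x \<in> W}"
  have "z \<in> f ` topspace X"
    using W openin_subset homeomorphic_imp_surjective_map[OF f] by blast
  then obtain x where x: "x \<in> topspace X" "z = f x" by blast
  have "openin X ?W"
    using homeomorphic_imp_continuous_map[OF f] W by (simp add: continuous_map_def)
  moreover have "x \<in> ?W" using x W by simp
  moreover have "\<forall>W x. openin X W \<and> x \<in> W \<longrightarrow>
      (\<exists>U K. openin X U \<and> compactin X K \<and> x \<in> U \<and> U \<subseteq> K \<and> K \<subseteq> W)"
    using X by (simp only: locally_compact_nbhds_def neighbourhood_base_of)
  ultimately obtain U K where "openin X U" "compactin X K" "x \<in> U" "U \<subseteq> K" "K \<subseteq> ?W"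
    by meson
  then show "\<exists>U K. openin Z U \<and> compactin Z K \<and> z \<in> U \<and> U \<subseteq> K \<and> K \<subseteq> W"
    using x homeomorphic_map_openness_eq[OF f] homeomorphic_map_compactness_eq[OF f]
    by (intro exI[of _ "f ` U"] exI[of _ "f ` K"]) auto
qed

context bumpy_functions
begin

lemma ultrafilter_groupoid_etale:
    "etale_groupoid (ultrafilter_groupoid mul D S) (ultrafilter_topology mul D S)" (is ?etale)
  and germs_composable_iff: "\<And>g h. g \<in> carrier G \<Longrightarrow> h \<in> carrier G \<Longrightarrow>
      (germs g, germs h) \<in> composable (ultrafilter_groupoid mul D S) \<longleftrightarrow> src G g = rng G h"
proof -
  have car: "carrier (ultrafilter_groupoid mul D S) = topspace (ultrafilter_topology mul D S)"
    by (simp add: ultrafilter_groupoid_def topspace_ultrafilter_topology)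
  have inv: "ginv (ultrafilter_groupoid mul D S) (germs g) = germs (ginv G g)" if "g \<in> carrier G" for g
    using germs_ginv[OF that] by (simp add: ultrafilter_groupoid_def)
  have mult: "germs g \<odot>\<^bsub>ultrafilter_groupoid mul D S\<^esub> germs h = germs (g \<odot> h)"
    if "(g, h) \<in> composable G" for g h
    using germs_gmult[OF that] by (simp add: ultrafilter_groupoid_def)
  note transport = etale_groupoid_transport[OF etale germs_homeomorphic car inv mult]
  show ?etale using transport(1) .
  show "(germs g, germs h) \<in> composable (ultrafilter_groupoid mul D S) \<longleftrightarrow> src G g = rng G h"
    if "g \<in> carrier G" "h \<in> carrier G" for g h
    using transport(2)[of g h] that by (simp add: composable_def)
qed

end

section \<open>Recovering the groupoid from its bumpy semigroup\<close>

theorem theorem5p3: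
  fixes G :: "'g groupoid_struct"
    and X :: "'g topology"
    and Y :: "'y monoid"
    and S D :: "('g \<rightharpoonup> 'y) set"
    and mul :: "('g \<rightharpoonup> 'y) \<Rightarrow> ('g \<rightharpoonup> 'y) \<Rightarrow> ('g \<rightharpoonup> 'y)"
    and \<S> :: "'g \<Rightarrow> ('g \<rightharpoonup> 'y) set"
  defines "mul \<equiv> pf_mult G Y"
    and "D \<equiv> diagonal G S"
    and "\<S> \<equiv> germ_set X Y S"
  assumes "groupoid G"
    and "topspace X = carrier G"
    and "Hausdorff_space (subtopology X (gunits G))"
    and "monoid Y"
    and "one_cancellative Y"
    and "bumpy_semigroup G X Y S"
  shows "topspace (ultrafilter_topology mul D S) = ultrafilters mul D S \<and>
    homeomorphic_map X (ultrafilter_topology mul D S) \<S> \<and>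
    (\<forall>g \<in> carrier G. \<forall>h \<in> carrier G. src G g = rng G h \<longrightarrow>
       \<S> (ginv G g) = star mul D S (\<S> g) \<and>
       \<S> (g \<odot>\<^bsub>G\<^esub> h) = up_closure mul D S (set_mult mul (\<S> g) (\<S> h))) \<and>
    etale_groupoid (ultrafilter_groupoid mul D S) (ultrafilter_topology mul D S) \<and>
    locally_compact_nbhds (ultrafilter_topology mul D S) \<and>
    (\<forall>g \<in> carrier G. \<forall>h \<in> carrier G.
       (\<S> g, \<S> h) \<in> composable (ultrafilter_groupoid mul D S) \<longleftrightarrow> src G g = rng G h)"
proof -
  have bumpy: "bumpy_functions G Y X S"
    using assms(4-) by (simp add: bumpy_functions_def bumpy_functions_axioms_def)
  note facts = bumpy_functions.topspace_ultrafilter_topology[OF bumpy]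
    bumpy_functions.germs_homeomorphic[OF bumpy]
    bumpy_functions.ultrafilter_groupoid_etale[OF bumpy]
    locally_compact_nbhds_transport[OF bumpy_functions.germs_homeomorphic[OF bumpy]
      bumpy_functions.locally_compact[OF bumpy]]
  show ?thesis
    unfolding assms(1-3)
    using facts bumpy_functions.germs_ginv[OF bumpy] bumpy_functions.germs_gmult[OF bumpy]
      bumpy_functions.germs_composable_iff[OF bumpy]
    by (intro conjI ballI impI) (simp_all add: composable_def)
qed

end
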